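(* For every constant $k\ge 3$ there is an algorithm which, given $n$, outputs in time polynomial in $n$ a circuit of depth $O(\log^2 n)$ and size polynomial in $n$ that computes $\mathrm{THR}^{kn+1}_{n+1}$ and consists only of $\mathrm{THR}^{k+1}_2$ gates and variables.
   Context: For integers $a,b$, $\mathrm{THR}^b_a\colon\{0,1\}^b\to\{0,1\}$ outputs $1$ iff its input contains at least $a$ ones. A circuit consisting only of $\mathrm{THR}^{k+1}_2$ gates and variables is a directed acyclic graph with a designated output node, in which each internal node is a $\mathrm{THR}^{k+1}_2$ gate with $k+1$ ordered inputs (each an edge to another node) and each input node (sink) is labeled by a variable $x_i$; no constants and no negations. Depth is the maximal length of a path from the output node to an input node; size is the number of nodes. *)

theory Defs
  imports
    Complex_Main
    "HOL-Library.Landau_Symbols"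
    "HOL-Computational_Algebra.Polynomial"
begin

section \<open>Threshold functions and circuits\<close>

text \<open>\<open>thr a\<close> restricted to lists of length \<open>b\<close> is the function $\mathrm{THR}^b_a$.\<close>

definition thr :: "nat \<Rightarrow> bool list \<Rightarrow> bool" where
  "thr a xs \<longleftrightarrow> a \<le> count_list xs True"

text \<open>Nodes are the positions of the list \<open>nodes C\<close>; they need not be listed in topological
  order, and a gate may use the same node for several of its ordered inputs. Variables are
  numbered from 0.\<close>

datatype node = Var nat | Thr2 "nat list"

record circuit =
  nodes :: "node list"
  out :: nat

definition edges :: "circuit \<Rightarrow> (nat \<times> nat) set" where
  "edges C = {(v, w). v < length (nodes C) \<and> (\<exists>ws. nodes C ! v = Thr2 ws \<and> w \<in> set ws)}"

definition input_nodes :: "circuit \<Rightarrow> nat set" where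
  "input_nodes C = {v. v < length (nodes C) \<and> (\<exists>i. nodes C ! v = Var i)}"

text \<open>\<open>thr2_circuit a m C\<close>: \<open>C\<close> is a circuit in \<open>m\<close> variables all of whose gates are
  $\mathrm{THR}^a_2$ gates.\<close>

definition thr2_circuit :: "nat \<Rightarrow> nat \<Rightarrow> circuit \<Rightarrow> bool" where
  "thr2_circuit a m C \<longleftrightarrow>
     out C < length (nodes C) \<and>
     (\<forall>i. Var i \<in> set (nodes C) \<longrightarrow> i < m) \<and>
     (\<forall>ws. Thr2 ws \<in> set (nodes C) \<longrightarrow> length ws = a \<and> (\<forall>w \<in> set ws. w < length (nodes C))) \<and>
     acyclic (edges C)"

inductive evaluates :: "circuit \<Rightarrow> bool list \<Rightarrow> nat \<Rightarrow> bool \<Rightarrow> bool" for C x where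
  evaluates_Var:
    "v < length (nodes C) \<Longrightarrow> nodes C ! v = Var i \<Longrightarrow> i < length x \<Longrightarrow> evaluates C x v (x ! i)"
| evaluates_Thr2:
    "v < length (nodes C) \<Longrightarrow> nodes C ! v = Thr2 ws \<Longrightarrow> list_all2 (evaluates C x) ws bs
     \<Longrightarrow> evaluates C x v (thr 2 bs)"

definition computes :: "circuit \<Rightarrow> nat \<Rightarrow> (bool list \<Rightarrow> bool) \<Rightarrow> bool" where
  "computes C m f \<longleftrightarrow> (\<forall>x. length x = m \<longrightarrow> evaluates C x (out C) (f x))"

definition circuit_size :: "circuit \<Rightarrow> nat" where
  "circuit_size C = length (nodes C)"

definition depth :: "circuit \<Rightarrow> nat" where
  "depth C = Max {d. \<exists>v \<in> input_nodes C. (out C, v) \<in> edges C ^^ d}"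

text \<open>Every node of a well-formed circuit has exactly one value, and the set whose maximum is
  the depth is finite and nonempty.\<close>

lemma thr2_circuitD:
  assumes "thr2_circuit a m C" "v < length (nodes C)"
  shows "nodes C ! v = Var i \<Longrightarrow> i < m"
    and "nodes C ! v = Thr2 ws \<Longrightarrow> length ws = a"
    and "nodes C ! v = Thr2 ws \<Longrightarrow> w \<in> set ws \<Longrightarrow> w < length (nodes C)"
  using assms nth_mem[OF assms(2)] unfolding thr2_circuit_def by auto

lemma evaluates_unique:
  "evaluates C x v b \<Longrightarrow> evaluates C x v b' \<Longrightarrow> b' = b"
proof (induction arbitrary: b' rule: evaluates.induct)
  case (evaluates_Var v i)
  from evaluates_Var.prems show ?case
    by (rule evaluates.cases) (use evaluates_Var.hyps in simp_all)
next
  case (evaluates_Thr2 v ws bs)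
  from evaluates_Thr2.prems obtain bs' where "list_all2 (evaluates C x) ws bs'" "b' = thr 2 bs'"
    by (rule evaluates.cases) (use evaluates_Thr2.hyps in simp_all)
  moreover have "bs' = bs" if "list_all2 (evaluates C x) ws bs'" for bs'
    using evaluates_Thr2.IH that
    by (intro nth_equalityI) (simp_all add: list_all2_conv_all_nth)
  ultimately show ?case by simp
qed

lemma wf_converse_edges:
  assumes "thr2_circuit a m C"
  shows "wf ((edges C)\<inverse>)"
proof -
  have "edges C \<subseteq> {..<length (nodes C)} \<times> {..<length (nodes C)}"
    using thr2_circuitD(3)[OF assms] by (auto simp: edges_def)
  then have "finite (edges C)"
    by (rule finite_subset) simp
  then show ?thesis
    using assms by (simp add: finite_acyclic_wf_converse thr2_circuit_def)
qed

lemma evaluates_total: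
  assumes C: "thr2_circuit a m C" and x: "length x = m"
  shows "v < length (nodes C) \<Longrightarrow> \<exists>b. evaluates C x v b"
proof (induction v rule: wf_induct_rule[OF wf_converse_edges[OF C]])
  case (1 v)
  show ?case
  proof (cases "nodes C ! v")
    case (Var i)
    then have "i < length x"
      using thr2_circuitD(1)[OF C 1(2)] x by simp
    then show ?thesis
      using 1(2) Var by (blast intro: evaluates_Var)
  next
    case (Thr2 ws)
    have "\<forall>w \<in> set ws. \<exists>b. evaluates C x w b"
    proof
      fix w assume w: "w \<in> set ws"
      have "w < length (nodes C)"
        using thr2_circuitD(3)[OF C 1(2) Thr2 w] .
      moreover have "(w, v) \<in> (edges C)\<inverse>"
        using 1(2) Thr2 w by (auto simp: edges_def)
      ultimately show "\<exists>b. evaluates C x w b"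
        using 1(1) by blast
    qed
    then obtain f where "\<forall>w \<in> set ws. evaluates C x w (f w)"
      by (auto dest: bchoice)
    then have "list_all2 (evaluates C x) ws (map f ws)"
      by (simp add: list_all2_conv_all_nth)
    then show ?thesis
      using 1(2) Thr2 by (blast intro: evaluates_Thr2)
  qed
qed

lemma depth_set_finite:
  assumes C: "thr2_circuit a m C"
  shows "finite {d. \<exists>v \<in> input_nodes C. (u, v) \<in> edges C ^^ d}"
proof (induction u rule: wf_induct_rule[OF wf_converse_edges[OF C]])
  case (1 u)
  let ?D = "\<lambda>u. {d. \<exists>v \<in> input_nodes C. (u, v) \<in> edges C ^^ d}"
  have fin: "finite (edges C `` {u})"
  proof (rule finite_subset)
    show "edges C `` {u} \<subseteq> {..<length (nodes C)}"
      using thr2_circuitD(3)[OF C] by (auto simp: edges_def)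
  qed simp
  have "?D u \<subseteq> insert 0 (\<Union>w \<in> edges C `` {u}. Suc ` ?D w)"
  proof
    fix d assume "d \<in> ?D u"
    then obtain v where v: "v \<in> input_nodes C" "(u, v) \<in> edges C ^^ d" by blast
    show "d \<in> insert 0 (\<Union>w \<in> edges C `` {u}. Suc ` ?D w)"
    proof (cases d)
      case (Suc e)
      with v(2) obtain w where "(u, w) \<in> edges C" "(w, v) \<in> edges C ^^ e"
        by (auto dest: relpow_Suc_D2 simp del: relpow.simps)
      with v(1) Suc show ?thesis by blast
    qed simp
  qed
  moreover have "finite (\<Union>w \<in> edges C `` {u}. Suc ` ?D w)"
    using fin 1 by auto
  ultimately show ?case
    using finite_subset by blast
qed

lemma depth_set_nonempty:
  assumes C: "thr2_circuit a m C" and a: "a > 0"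
  shows "u < length (nodes C) \<Longrightarrow> {d. \<exists>v \<in> input_nodes C. (u, v) \<in> edges C ^^ d} \<noteq> {}"
proof (induction u rule: wf_induct_rule[OF wf_converse_edges[OF C]])
  case (1 u)
  show ?case
  proof (cases "nodes C ! u")
    case (Var i)
    then have "u \<in> input_nodes C" "(u, u) \<in> edges C ^^ 0"
      using 1(2) by (auto simp: input_nodes_def)
    then show ?thesis by blast
  next
    case (Thr2 ws)
    have ws: "length ws = a" "\<forall>w \<in> set ws. w < length (nodes C)"
      using thr2_circuitD(2,3)[OF C 1(2) Thr2] by auto
    then obtain w where w: "w \<in> set ws" using a by (cases ws) auto
    have e: "(u, w) \<in> edges C"
      using 1(2) Thr2 w by (auto simp: edges_def)
    then obtain d v where "v \<in> input_nodes C" "(w, v) \<in> edges C ^^ d"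
      using 1(1)[of w] ws w by auto
    then have "v \<in> input_nodes C \<and> (u, v) \<in> edges C ^^ Suc d"
      using e by (auto intro: relpow_Suc_I2 simp del: relpow.simps)
    then show ?thesis by blast
  qed
qed


section \<open>Algorithms and running time\<close>

text \<open>Random-access machines with addition and truncated subtraction at unit cost, with
  structured control flow. A program names finitely many registers and has an unbounded memory
  addressed by register contents. Multiplication is deliberately not primitive: in \<open>t\<close> steps the
  contents of a cell can only grow by a factor exponential in \<open>t\<close>, so that they keep polynomially
  many bits and polynomial time agrees with polynomial time on Turing machines.\<close>

datatype com =
    Const nat nat
  | Add nat nat nat
  | Sub nat nat nat
  | Load nat nat
  | Store nat nat
  | Emit nat
  | Seq com com
  | Ifnz nat com com
  | Whilenz nat com

record ram =
  reg :: "nat \<Rightarrow> nat"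
  mem :: "nat \<Rightarrow> nat"
  emitted :: "nat list"

text \<open>\<open>exec c s t s'\<close>: started in state \<open>s\<close>, \<open>c\<close> halts in state \<open>s'\<close> after exactly \<open>t\<close> steps,
  where every primitive command and every test counts as one step.\<close>

inductive exec :: "com \<Rightarrow> ram \<Rightarrow> nat \<Rightarrow> ram \<Rightarrow> bool" where
  exec_Const: "exec (Const r c) s 1 (s\<lparr>reg := (reg s)(r := c)\<rparr>)"
| exec_Add: "exec (Add r i j) s 1 (s\<lparr>reg := (reg s)(r := reg s i + reg s j)\<rparr>)"
| exec_Sub: "exec (Sub r i j) s 1 (s\<lparr>reg := (reg s)(r := reg s i - reg s j)\<rparr>)"
| exec_Load: "exec (Load r i) s 1 (s\<lparr>reg := (reg s)(r := mem s (reg s i))\<rparr>)"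
| exec_Store: "exec (Store i r) s 1 (s\<lparr>mem := (mem s)(reg s i := reg s r)\<rparr>)"
| exec_Emit: "exec (Emit r) s 1 (s\<lparr>emitted := emitted s @ [reg s r]\<rparr>)"
| exec_Seq: "exec c s t s' \<Longrightarrow> exec c' s' t' s'' \<Longrightarrow> exec (Seq c c') s (t + t') s''"
| exec_Ifnz_True: "reg s r \<noteq> 0 \<Longrightarrow> exec c s t s' \<Longrightarrow> exec (Ifnz r c c') s (Suc t) s'"
| exec_Ifnz_False: "reg s r = 0 \<Longrightarrow> exec c' s t s' \<Longrightarrow> exec (Ifnz r c c') s (Suc t) s'"
| exec_Whilenz_False: "reg s r = 0 \<Longrightarrow> exec (Whilenz r c) s 1 s"
| exec_Whilenz_True:
    "reg s r \<noteq> 0 \<Longrightarrow> exec c s t s' \<Longrightarrow> exec (Whilenz r c) s' t' s''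
     \<Longrightarrow> exec (Whilenz r c) s (Suc (t + t')) s''"

inductive_cases exec_ConstE: "exec (Const r c) s t s'"
inductive_cases exec_AddE: "exec (Add r i j) s t s'"
inductive_cases exec_SubE: "exec (Sub r i j) s t s'"
inductive_cases exec_LoadE: "exec (Load r i) s t s'"
inductive_cases exec_StoreE: "exec (Store i r) s t s'"
inductive_cases exec_EmitE: "exec (Emit r) s t s'"
inductive_cases exec_SeqE: "exec (Seq c c') s t s'"
inductive_cases exec_IfnzE: "exec (Ifnz r c c') s t s'"
inductive_cases exec_WhilenzE: "exec (Whilenz r c) s t s'"

lemma exec_deterministic:
  "exec c s t s' \<Longrightarrow> exec c s u s'' \<Longrightarrow> u = t \<and> s'' = s'"
proof (induction arbitrary: u s'' rule: exec.induct)
  case exec_Const then show ?case by (rule exec_ConstE) simp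
next
  case exec_Add then show ?case by (rule exec_AddE) simp
next
  case exec_Sub then show ?case by (rule exec_SubE) simp
next
  case exec_Load then show ?case by (rule exec_LoadE) simp
next
  case exec_Store then show ?case by (rule exec_StoreE) simp
next
  case exec_Emit then show ?case by (rule exec_EmitE) simp
next
  case (exec_Seq c s t s' c' t' s2)
  from exec_Seq.prems obtain v v' z
    where "u = v + v'" "exec c s v z" "exec c' z v' s''"
    by (rule exec_SeqE)
  then show ?case using exec_Seq.IH(1)[of v z] exec_Seq.IH(2)[of v' s''] by simp
next
  case (exec_Ifnz_True s r c t s' c')
  from exec_Ifnz_True.prems obtain v where "u = Suc v" "exec c s v s''"
    by (rule exec_IfnzE) (use exec_Ifnz_True.hyps in simp_all)
  then show ?case using exec_Ifnz_True.IH[of v s''] by simp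
next
  case (exec_Ifnz_False s r c' t s' c)
  from exec_Ifnz_False.prems obtain v where "u = Suc v" "exec c' s v s''"
    by (rule exec_IfnzE) (use exec_Ifnz_False.hyps in simp_all)
  then show ?case using exec_Ifnz_False.IH[of v s''] by simp
next
  case (exec_Whilenz_False s r c)
  from exec_Whilenz_False.prems show ?case
    by (rule exec_WhilenzE) (use exec_Whilenz_False.hyps in simp_all)
next
  case (exec_Whilenz_True s r c t s' t' s2)
  from exec_Whilenz_True.prems obtain v v' z
    where "u = Suc (v + v')" "exec c s v z" "exec (Whilenz r c) z v' s''"
    by (rule exec_WhilenzE) (use exec_Whilenz_True.hyps in simp_all)
  then show ?case
    using exec_Whilenz_True.IH(1)[of v z] exec_Whilenz_True.IH(2)[of v' s''] by simp
qed

definition initial :: "nat \<Rightarrow> ram" where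
  "initial n = \<lparr>reg = (\<lambda>_. 0)(0 := n), mem = (\<lambda>_. 0), emitted = []\<rparr>"

text \<open>Time is measured in the value of the input \<open>n\<close>, not in its binary length.\<close>

definition outputs_in_poly_time :: "com \<Rightarrow> (nat \<Rightarrow> nat list) \<Rightarrow> bool" where
  "outputs_in_poly_time P f \<longleftrightarrow>
     (\<exists>p :: nat poly. \<forall>n. \<exists>t s. exec P (initial n) t s \<and> emitted s = f n \<and> t \<le> poly p n)"

fun encode_node :: "node \<Rightarrow> nat list" where
  "encode_node (Var i) = [0, i]"
| "encode_node (Thr2 ws) = 1 # length ws # ws"

definition encode_circuit :: "circuit \<Rightarrow> nat list" where
  "encode_circuit C = out C # concat (map encode_node (nodes C))"

lemma encode_node_prefix_free:
  "encode_node u @ xs = encode_node v @ ys \<Longrightarrow> u = v \<and> xs = ys"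
  by (cases u; cases v) auto

lemma inj_encode_circuit: "inj encode_circuit"
proof
  fix C D :: circuit assume eq: "encode_circuit C = encode_circuit D"
  have "us = vs" if "concat (map encode_node us) = concat (map encode_node vs)" for us vs
    using that
  proof (induction us arbitrary: vs)
    case Nil
    then show ?case by (cases vs; cases "hd vs") auto
  next
    case (Cons u us)
    show ?case
    proof (cases vs)
      case Nil
      with Cons show ?thesis by (cases u) auto
    next
      case (Cons v vs')
      with Cons.prems Cons.IH[of vs'] show ?thesis
        by (auto dest: encode_node_prefix_free)
    qed
  qed
  with eq show "C = D"
    by (simp add: encode_circuit_def)
qed

end

theory Submission
  imports Defs "HOL-Library.Log_Nat"
begin

text \<open>
  Let $N = kn + 1$. Since a $\mathrm{THR}^{k+1}_2$ gate with value 0 has at most one input with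
  value 1, any $k$ inputs on which a circuit outputs 0 have a common zero variable. If a circuit
  outputs 0 on all inputs with at most $n$ ones, it therefore outputs 1 on every \<open>x\<close> with more than
  $n$ ones: the at most $(k-1)n$ zeros of \<open>x\<close> are covered by $k-1$ inputs with at most $n$ ones each.

  It remains to force the value 0 on the inputs with at most $n$ ones, which is done by simulating
  a $k$-party protocol. Given $k$ such inputs, a common zero is found by binary search for a segment
  of positions that is longer than the total number of ones of the $k$ inputs in it; each party
  announces its number of ones in the left half of the current segment. A node of the circuit stands for $k$ classes
  of inputs and outputs 0 on their union. As it is unknown which party an input should play, the node
  stores a segment for each of the $k^k$ assignments of the $k$ parties to classes. The numbers of
  ones are found bit by bit: refining one class by one bit gives $k+1$ classes, and the $j$-th child
  of the gate forgets the $j$-th of them, so that each input is missing from one child only. This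
  takes $O(\log n)$ rounds of $O(\log n)$ layers, and a node is described by a constant number of
  digits bounded by $O(n)$, so that the circuit is written down by nested loops.
\<close>

section \<open>Enumerating digit sequences\<close>

text \<open>A class is known only through upper bounds for its ones in each segment; its members
  need not agree in their counts. During a round the segments and bounds stay fixed while the
  classes are refined. A slot may then be overwritten by a part of another class, so
  \<open>Parent\<close> records where each slot comes from, and \<open>Guess t i\<close> pairs a
  tuple \<open>t\<close> of old classes with a refined class \<open>i\<close>. Overwriting mixes
  precisions: a slot must not be credited with more precision than the class copied into it has.
  This is ensured by determining a bit for every pair of a tuple and a class before the next bit is
  begun. Since all \<open>k\<close> slots are always filled, some classes have no members and may
  carry inconsistent numbers; \<open>left_ones\<close> and \<open>clip\<close> absorb these. A bit
  costs \<open>k ^ k * k\<close> layers, and there are \<open>levels n\<close> bits in each of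
  \<open>levels n\<close> rounds. The number of digits depends on \<open>k\<close> only, so every
  digit sequence can be made a node, whether or not it arises in the simulation.\<close>

fun enum :: "nat \<Rightarrow> nat \<Rightarrow> nat list list" where
  "enum 0 B = [[]]"
| "enum (Suc D) B = concat (map (\<lambda>d. map ((#) d) (enum D B)) [0..<B])"

text \<open>The rank of a sequence in \<open>enum\<close>: with the most significant digit first,
  lexicographic order is numerical order. Nested loops visit the sequences in this order
  too.\<close>

fun enc :: "nat \<Rightarrow> nat list \<Rightarrow> nat" where
  "enc B [] = 0"
| "enc B (d # ds) = d * B ^ length ds + enc B ds"

lemma length_concat_blocks:
  assumes "\<And>l. l < L \<Longrightarrow> length (f l) = M"
  shows "length (concat (map f [0..<L])) = L * M"
  using assms by (induction L) auto

lemma nth_concat_blocks: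
  assumes "\<And>l. l < L \<Longrightarrow> length (f l) = M" "l < L" "c < M"
  shows "concat (map f [0..<L]) ! (l * M + c) = f l ! c"
  using assms
proof (induction L)
  case (Suc L)
  have len: "length (concat (map f [0..<L])) = L * M"
    by (rule length_concat_blocks) (use Suc.prems in simp)
  show ?case
  proof (cases "l = L")
    case True
    then show ?thesis using len by (simp add: nth_append)
  next
    case False
    then have "l < L" using Suc.prems by simp
    moreover have "l * M + c < L * M"
    proof -
      have "l * M + c < Suc l * M" using Suc.prems by simp
      also have "\<dots> \<le> L * M" using \<open>l < L\<close> by (intro mult_le_mono1) simp
      finally show ?thesis .
    qed
    ultimately show ?thesis using Suc len by (simp add: nth_append)
  qed
qed simp

lemma length_enum: "length (enum D B) = B ^ D"
  by (induction D) (simp_all add: length_concat_blocks)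

lemma set_enum: "ds \<in> set (enum D B) \<longleftrightarrow> length ds = D \<and> set ds \<subseteq> {..<B}"
proof (induction D arbitrary: ds)
  case (Suc D)
  show ?case
    by (cases ds) (use Suc in \<open>auto simp: image_iff\<close>)
qed auto

lemma nth_enum:
  assumes "set ds \<subseteq> {..<B}"
  shows "enc B ds < B ^ length ds \<and> enum (length ds) B ! enc B ds = ds"
  using assms
proof (induction ds)
  case (Cons d ds)
  then have IH: "enc B ds < B ^ length ds" "enum (length ds) B ! enc B ds = ds" and d: "d < B"
    by auto
  have "d * B ^ length ds + enc B ds < Suc d * B ^ length ds" using IH by simp
  also have "\<dots> \<le> B * B ^ length ds" using d by (intro mult_le_mono1) simp
  finally show ?case
    using IH d by (simp add: nth_concat_blocks[where M = "B ^ length ds"] length_enum)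
qed simp

definition pos :: "'a list \<Rightarrow> 'a \<Rightarrow> nat" where
  "pos xs x = length (takeWhile (\<lambda>y. y \<noteq> x) xs)"

lemma pos:
  assumes "x \<in> set xs"
  shows "pos xs x < length xs" "xs ! pos xs x = x"
proof -
  show "pos xs x < length xs"
    unfolding pos_def using assms
    by (metis (mono_tags, lifting) length_takeWhile_le order_le_imp_less_or_eq takeWhile_eq_all_conv takeWhile_eq_take take_all_iff order_refl)
  then show "xs ! pos xs x = x"
    unfolding pos_def using nth_length_takeWhile by fastforce
qed

section \<open>Counting ones\<close>

definition ones :: "bool list \<Rightarrow> nat \<Rightarrow> nat \<Rightarrow> nat" where
  "ones z a len = card {j. a \<le> j \<and> j < a + len \<and> j < length z \<and> z ! j}"

lemma ones_add: "ones z a (s + t) = ones z a s + ones z (a + s) t"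
proof -
  let ?S = "\<lambda>a len. {j. a \<le> j \<and> j < a + len \<and> j < length z \<and> z ! j}"
  have "?S a (s + t) = ?S a s \<union> ?S (a + s) t" by auto
  moreover have "card (?S a s \<union> ?S (a + s) t) = card (?S a s) + card (?S (a + s) t)"
    by (rule card_Un_disjoint) auto
  ultimately show ?thesis unfolding ones_def by simp
qed

lemma count_True_eq_card: "count_list z True = card {j. j < length z \<and> z ! j}"
proof -
  have "filter ((=) True) z = filter (\<lambda>b. b) z" by (rule filter_cong) auto
  then show ?thesis by (simp add: count_list_eq_length_filter length_filter_conv_card)
qed

lemma ones_le: "ones z a len \<le> count_list z True"
  unfolding ones_def count_True_eq_card by (rule card_mono) auto

lemma ones_0_1: "ones z a 1 = 0 \<Longrightarrow> a < length z \<Longrightarrow> \<not> z ! a"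
  unfolding ones_def by (auto simp: le_less_Suc_eq)

lemma count_True_le_1I:
  assumes "\<And>j. j < length bs \<Longrightarrow> j \<noteq> b \<Longrightarrow> \<not> bs ! j"
  shows "\<not> thr 2 bs"
proof -
  have "{j. j < length bs \<and> bs ! j} \<subseteq> {b}" using assms by auto
  then have "card {j. j < length bs \<and> bs ! j} \<le> 1"
    using card_mono[of "{b}"] by simp
  then show ?thesis by (simp add: thr_def count_True_eq_card)
qed

lemma not_thr2D:
  assumes "\<not> thr 2 bs" "i < length bs" "j < length bs" "bs ! i" "bs ! j"
  shows "i = j"
proof (rule ccontr)
  assume "i \<noteq> j"
  have "card {i, j} \<le> card {j. j < length bs \<and> bs ! j}"
    using assms by (intro card_mono) auto
  then show False
    using assms(1) \<open>i \<noteq> j\<close> by (simp add: thr_def count_True_eq_card)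
qed

section \<open>Simulating the protocol\<close>

text \<open>A state assigns to each tuple \<open>t\<close> of classes, where party \<open>p\<close> plays class \<open>t ! p\<close>, the
  first position \<open>Start t\<close> of its segment; inputs of class \<open>c\<close> have at most \<open>Bound t c\<close> ones there.
  While these classes are refined, \<open>Parent i\<close> is the class that the \<open>i\<close>-th refined class comes
  from, and \<open>Guess t i\<close> is a lower bound for the number of ones in the left half of the segment.\<close>

datatype key = Start "nat list" | Bound "nat list" nat | Parent nat | Guess "nat list" nat

text \<open>\<open>Split w t i\<close> determines one bit, of weight \<open>w\<close>, of the number
  of ones that inputs of class \<open>i\<close> have in the left half of the segment of
  \<open>t\<close>. \<open>Commit s\<close> uses the numbers found to pass to halves of length
  \<open>s\<close>.\<close>

datatype layer = Split nat "nat list" nat | Commit nat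

locale arity =
  fixes k :: nat
  assumes k_pos: "0 < k"
begin

definition tuples :: "nat list list" where
  "tuples = enum k k"

lemma tuples: "t \<in> set tuples \<longleftrightarrow> length t = k \<and> set t \<subseteq> {..<k}"
  by (simp add: tuples_def set_enum)

definition keys :: "key list" where
  "keys = map Start tuples @ concat (map (\<lambda>t. map (Bound t) [0..<k]) tuples)
     @ map Parent [0..<k] @ concat (map (\<lambda>t. map (Guess t) [0..<k]) tuples)"

lemma keys:
  "Start t \<in> set keys \<longleftrightarrow> t \<in> set tuples"
  "Bound t i \<in> set keys \<longleftrightarrow> t \<in> set tuples \<and> i < k"
  "Parent i \<in> set keys \<longleftrightarrow> i < k"
  "Guess t i \<in> set keys \<longleftrightarrow> t \<in> set tuples \<and> i < k"
  by (auto simp: keys_def image_iff)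

definition nvars :: "nat \<Rightarrow> nat" where
  "nvars n = k * n + 1"

definition levels :: "nat \<Rightarrow> nat" where
  "levels n = floorlog 2 (nvars n)"

text \<open>Segment starts and counts of ones stay below \<open>2 ^ levels n\<close>, parents below
  \<open>k\<close>; the sum leaves room for both kinds of digit.\<close>

definition base :: "nat \<Rightarrow> nat" where
  "base n = 2 ^ levels n + k"

lemma less_levels_iff: "x < levels n \<longleftrightarrow> 2 ^ x \<le> nvars n"
proof -
  have "2 ^ x \<le> nvars n \<longleftrightarrow> (2::real) ^ x \<le> real (nvars n)"
    by (metis of_nat_le_iff of_nat_numeral of_nat_power)
  also have "\<dots> \<longleftrightarrow> x \<le> log 2 (nvars n)"
    by (subst le_log_iff) (simp_all add: powr_realpow nvars_def add_pos_nonneg)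
  also have "\<dots> \<longleftrightarrow> int x \<le> \<lfloor>log 2 (nvars n)\<rfloor>"
    by (simp add: le_floor_iff)
  finally have "2 ^ x \<le> nvars n \<longleftrightarrow> int x \<le> \<lfloor>log 2 (nvars n)\<rfloor>" .
  moreover have "1 \<le> real (nvars n)" by (simp add: nvars_def)
  then have "0 \<le> \<lfloor>log 2 (nvars n)\<rfloor>" by simp
  moreover have "levels n = nat \<lfloor>log 2 (nvars n)\<rfloor> + 1"
    by (simp add: levels_def floorlog_def nvars_def)
  ultimately show ?thesis by linarith
qed

lemma nvars_less: "nvars n < 2 ^ levels n"
  using less_levels_iff[of "levels n" n] by simp

text \<open>The default 0 keeps \<open>child\<close> meaningful on digit sequences that describe no
  proper state; \<open>caseE\<close> falls back to the same value.\<close>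

definition parent :: "(key \<Rightarrow> nat) \<Rightarrow> nat \<Rightarrow> nat" where
  "parent st i = (if st (Parent i) < k then st (Parent i) else 0)"

text \<open>The minimum differs from the guess only for empty classes. It ensures that the bounds for the
  two halves of a segment add up to the bound for the whole segment.\<close>

definition left_ones :: "(key \<Rightarrow> nat) \<Rightarrow> nat list \<Rightarrow> nat \<Rightarrow> nat" where
  "left_ones st t i = min (st (Guess t i)) (st (Bound t (parent st i)))"

text \<open>The minimum is the number of variables in the left half: segments have lengths that are
  powers of two and may extend beyond \<open>N\<close>. The tuple \<open>t\<close> consists of
  refined classes, and their parents select the segment. A class played by several parties is
  counted once for each.\<close>

definition go_left :: "nat \<Rightarrow> nat \<Rightarrow> (key \<Rightarrow> nat) \<Rightarrow> nat list \<Rightarrow> bool" where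
  "go_left N s st t \<longleftrightarrow>
     sum_list (map (left_ones st (map (parent st) t)) t)
       < min (N - st (Start (map (parent st) t))) s"

text \<open>A split yields \<open>k + 1\<close> classes for \<open>k\<close> slots. For
  \<open>j < k\<close> other than \<open>i\<close>, slot \<open>j\<close> is overwritten by the
  upper half of class \<open>i\<close>. Child \<open>i\<close> leaves the state as it is and thereby
  forgets the upper half; child \<open>k\<close> raises the guess and thereby forgets the lower
  half. \<open>Commit\<close> makes no choice, so its \<open>k + 1\<close> children are
  equal.\<close>

fun child :: "nat \<Rightarrow> layer \<Rightarrow> nat \<Rightarrow> (key \<Rightarrow> nat) \<Rightarrow> key \<Rightarrow> nat" where
  "child N (Split w t i) j st (Start u) = st (Start u)"
| "child N (Split w t i) j st (Bound u l) = st (Bound u l)"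
| "child N (Split w t i) j st (Parent l) = st (Parent (if l = j then i else l))"
| "child N (Split w t i) j st (Guess u l) = st (Guess u (if l = j then i else l))
     + (if u = t \<and> (j \<noteq> i \<and> l = j \<or> j = k \<and> l = i) then w else 0)"
| "child N (Commit s) j st (Start u) =
     st (Start (map (parent st) u)) + (if go_left N s st u then 0 else s)"
| "child N (Commit s) j st (Bound u l) =
     (if go_left N s st u then left_ones st (map (parent st) u) l
      else st (Bound (map (parent st) u) (parent st l)) - st (Guess (map (parent st) u) l))"
| "child N (Commit s) j st (Parent l) = l"
| "child N (Commit s) j st (Guess u l) = 0"

section \<open>Digit sequences as states, and the values of nodes\<close>

definition state :: "nat list \<Rightarrow> key \<Rightarrow> nat" where
  "state ds q = ds ! pos keys q"

lemma state_map: "q \<in> set keys \<Longrightarrow> state (map f keys) q = f q"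
  using pos[of q keys] by (simp add: state_def)

text \<open>Only guesses of empty classes overflow, so that replacing them by 0 does no harm.\<close>

definition clip :: "nat \<Rightarrow> nat \<Rightarrow> nat" where
  "clip B v = (if v < B then v else 0)"

definition child_digits :: "nat \<Rightarrow> layer \<Rightarrow> nat \<Rightarrow> nat list \<Rightarrow> nat list" where
  "child_digits n L j ds = map (\<lambda>q. clip (base n) (child (nvars n) L j (state ds) q)) keys"

text \<open>Every class plays in the tuple \<open>[0..<k]\<close>, so once its segment has length 1
  and all bounds are 0, the position is a zero of the members of all classes. Clipping gives the
  remaining digit sequences an admissible variable.\<close>

definition leaf_var :: "nat \<Rightarrow> nat list \<Rightarrow> nat" where
  "leaf_var n ds = clip (nvars n) (state ds (Start [0..<k]))"

fun val :: "nat \<Rightarrow> bool list \<Rightarrow> layer list \<Rightarrow> nat list \<Rightarrow> bool" where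
  "val n z [] ds = z ! leaf_var n ds"
| "val n z (L # Ls) ds = thr 2 (map (\<lambda>j. val n z Ls (child_digits n L j ds)) [0..<k + 1])"

lemma leaf_var_less: "leaf_var n ds < nvars n"
  by (simp add: leaf_var_def clip_def nvars_def)

text \<open>Independent of what states mean. If each of the \<open>k + 1\<close> children had value
  1 on some input in \<open>X\<close>, two children would share such an input by the pigeonhole
  principle, and the gate would have value 1 on it. So some child has value 0 on all of
  \<open>X\<close>.\<close>

lemma val_common_zero:
  assumes "finite X" "card X \<le> k" "\<And>z. z \<in> X \<Longrightarrow> \<not> val n z Ls ds"
  shows "\<exists>i < nvars n. \<forall>z \<in> X. \<not> z ! i"
  using assms(3)
proof (induction Ls arbitrary: ds)
  case Nil
  then show ?case using leaf_var_less by auto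
next
  case (Cons L Ls)
  let ?v = "\<lambda>j z. val n z Ls (child_digits n L j ds)"
  have "\<exists>j < k + 1. \<forall>z \<in> X. \<not> ?v j z"
  proof (rule ccontr)
    assume "\<not> ?thesis"
    then have "\<forall>j \<in> {..<k + 1}. \<exists>z. z \<in> X \<and> ?v j z" by auto
    then obtain g where g: "\<And>j. j < k + 1 \<Longrightarrow> g j \<in> X \<and> ?v j (g j)"
      by (metis lessThan_iff)
    have "\<not> inj_on g {..<k + 1}"
      using card_inj_on_le[of g "{..<k + 1}" X] g assms by auto
    then obtain i j where ij: "i < k + 1" "j < k + 1" "g i = g j" "i \<noteq> j"
      by (auto simp: inj_on_def)
    have "\<not> thr 2 (map (\<lambda>j. ?v j (g i)) [0..<k + 1])"
      using Cons.prems[of "g i"] g ij by simp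
    from not_thr2D[OF this, of i j] show False
      using g[of i] g[of j] ij by (simp del: upt_Suc)
  qed
  then show ?case using Cons.IH by blast
qed

text \<open>The strict inequality is the invariant of the binary search: the ones of the parties
  cannot cover all variables in the segment. Guesses are unconstrained because they may be wrong for
  empty classes.\<close>

definition wf_state :: "nat \<Rightarrow> nat \<Rightarrow> (key \<Rightarrow> nat) \<Rightarrow> bool" where
  "wf_state n len st \<longleftrightarrow>
     (\<forall>i < k. st (Parent i) < k) \<and>
     (\<forall>t \<in> set tuples. st (Start t) + len \<le> 2 ^ levels n \<and> (\<forall>i < k. st (Bound t i) \<le> n) \<and>
        (\<Sum>i\<leftarrow>t. st (Bound t i)) < min (nvars n - st (Start t)) len)"

definition in_class :: "(key \<Rightarrow> nat) \<Rightarrow> nat \<Rightarrow> nat \<Rightarrow> bool list \<Rightarrow> bool" where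
  "in_class st len c z \<longleftrightarrow> (\<forall>t \<in> set tuples. ones z (st (Start t)) len \<le> st (Bound t c))"

text \<open>\<open>W t i\<close> is the number of values still possible for the count that
  \<open>Guess t i\<close> approximates. Bounds refer to the parent class and the whole segment of
  length \<open>2 * s\<close>, guesses to its left half.\<close>

definition in_subclass ::
    "(key \<Rightarrow> nat) \<Rightarrow> nat \<Rightarrow> (nat list \<Rightarrow> nat \<Rightarrow> nat) \<Rightarrow> nat \<Rightarrow> bool list \<Rightarrow> bool" where
  "in_subclass st s W i z \<longleftrightarrow> in_class st (2 * s) (st (Parent i)) z \<and>
     (\<forall>t \<in> set tuples. ones z (st (Start t)) s \<in> {st (Guess t i)..<st (Guess t i) + W t i})"

definition rejects :: "nat \<Rightarrow> layer list \<Rightarrow> nat \<Rightarrow> (nat list \<Rightarrow> nat \<Rightarrow> nat) \<Rightarrow> bool" where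
  "rejects n Ls s W \<longleftrightarrow> (\<forall>ds z i. length z = nvars n \<longrightarrow> count_list z True \<le> n \<longrightarrow>
     wf_state n (2 * s) (state ds) \<longrightarrow> i < k \<longrightarrow> in_subclass (state ds) s W i z \<longrightarrow> \<not> val n z Ls ds)"

lemma not_valI:
  assumes "\<And>j. j \<le> k \<Longrightarrow> j \<noteq> b \<Longrightarrow> \<not> val n z Ls (child_digits n L j ds)"
  shows "\<not> val n z (L # Ls) ds"
  unfolding val.simps
  by (rule count_True_le_1I[of _ b]) (use assms in \<open>simp del: upt_Suc\<close>)

lemma state_child_digits:
  "q \<in> set keys \<Longrightarrow> state (child_digits n L j ds) q
     = clip (base n) (child (nvars n) L j (state ds) q)"
  by (simp add: child_digits_def state_map)

lemma n_less: "n < nvars n"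
proof -
  have "1 * n \<le> k * n" by (rule mult_le_mono1) (use k_pos in simp)
  then show ?thesis unfolding nvars_def by linarith
qed

lemma n_less_base: "n < base n"
  using n_less[of n] nvars_less[of n] by (simp add: base_def)

lemma clip_id: "v < B \<Longrightarrow> clip B v = v"
  by (simp add: clip_def)

text \<open>Segments and bounds belong to the old classes, so the invariant survives whichever
  refined class is forgotten.\<close>

lemma split_state:
  fixes w j
  assumes "wf_state n len (state ds)" "0 < len" "i < k" "t \<in> set tuples"
  defines "st' \<equiv> state (child_digits n (Split w t i) j ds)"
  shows "u \<in> set tuples \<Longrightarrow> st' (Start u) = state ds (Start u)"
    and "u \<in> set tuples \<Longrightarrow> l < k \<Longrightarrow> st' (Bound u l) = state ds (Bound u l)"
    and "l < k \<Longrightarrow> st' (Parent l) = state ds (Parent (if l = j then i else l))"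
    and "wf_state n len st'"
proof -
  show 1: "st' (Start u) = state ds (Start u)" if "u \<in> set tuples" for u
  proof -
    have "state ds (Start u) + len \<le> 2 ^ levels n"
      using assms(1) that by (auto simp: wf_state_def)
    then show ?thesis
      using that \<open>0 < len\<close> by (simp add: st'_def state_child_digits keys clip_id base_def)
  qed
  show 2: "st' (Bound u l) = state ds (Bound u l)" if "u \<in> set tuples" "l < k" for u l
  proof -
    have "state ds (Bound u l) \<le> n"
      using assms(1) that by (auto simp: wf_state_def)
    then show ?thesis
      using that n_less_base[of n] by (simp add: st'_def state_child_digits keys clip_id)
  qed
  show 3: "st' (Parent l) = state ds (Parent (if l = j then i else l))" if "l < k" for l
  proof -
    have "state ds (Parent (if l = j then i else l)) < k"
      using assms(1,3) that by (auto simp: wf_state_def)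
    then show ?thesis
      using that by (simp add: st'_def state_child_digits keys clip_id base_def)
  qed
  have 4: "(\<Sum>i\<leftarrow>u. st' (Bound u i)) = (\<Sum>i\<leftarrow>u. state ds (Bound u i))" if "u \<in> set tuples" for u
    using that 2 tuples by (intro arg_cong[of _ _ sum_list] map_cong) auto
  show "wf_state n len st'"
    using assms(1,3) 1 2 3 4 by (simp add: wf_state_def)
qed

text \<open>Child \<open>j\<close> reuses the slot of class \<open>j\<close> for the upper half of class \<open>i\<close>. By assumption \<open>le\<close>
  the uncertainty attached to that slot is at least that of class \<open>i\<close>, so the copy can only gain
  members.\<close>

lemma split_rejects:
  assumes Ls: "rejects n Ls s W'"
    and t: "t \<in> set tuples" and i: "i < k" and s: "0 < s"
    and W: "W t i = 2 * w" "W' t i = w" "\<And>u l. (u, l) \<noteq> (t, i) \<Longrightarrow> W' u l = W u l"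
    and le: "\<And>u l. u \<noteq> t \<Longrightarrow> l < k \<Longrightarrow> W u i \<le> W u l" "\<And>l. l < k \<Longrightarrow> w \<le> W' t l"
  shows "rejects n (Split w t i # Ls) s W"
  unfolding rejects_def
proof (intro allI impI)
  fix ds z l
  let ?st = "state ds"
  assume z: "length z = nvars n" "count_list z True \<le> n"
    and wf: "wf_state n (2 * s) ?st" and l: "l < k" and sub: "in_subclass ?st s W l z"
  let ?L = "Split w t i"
  have "0 < 2 * s" using s by simp
  note st' = split_state[OF wf this i t]
  have small: "ones z a b < base n" for a b
    using ones_le[of z a b] z(2) n_less_base[of n] by linarith
  \<comment> \<open>Slot \<open>m\<close> of child \<open>j\<close> descends from the class
    \<open>l\<close> of \<open>z\<close> and still contains \<open>z\<close>. Its guess is at most a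
    true count and hence below \<open>base n\<close>, so clipping does not change it.\<close>
  have step: "\<not> val n z Ls (child_digits n ?L j ds)"
    if m: "m < k" and src: "(if m = j then i else m) = l"
      and g: "\<And>u. u \<in> set tuples \<Longrightarrow> ones z (?st (Start u)) s \<in>
        {child (nvars n) ?L j ?st (Guess u m)..<child (nvars n) ?L j ?st (Guess u m) + W' u m}" for j m
  proof -
    let ?st' = "state (child_digits n ?L j ds)"
    have "ones z (?st' (Start u)) s \<in> {?st' (Guess u m)..<?st' (Guess u m) + W' u m}"
      if u: "u \<in> set tuples" for u
    proof -
      have "child (nvars n) ?L j ?st (Guess u m) < base n"
        using g[OF u] small[of "?st (Start u)" s] by simp
      then have "?st' (Guess u m) = child (nvars n) ?L j ?st (Guess u m)"
        using u m by (simp only: state_child_digits keys clip_id)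
      then show ?thesis using g[OF u] st'(1)[OF u] by simp
    qed
    moreover have "?st' (Parent m) = ?st (Parent l)"
      using st'(3)[OF m] src by simp
    moreover have "?st (Parent l) < k" using wf l by (simp add: wf_state_def)
    ultimately have "in_subclass ?st' s W' m z"
      using sub st'(1,2) by (simp add: in_subclass_def in_class_def)
    then show ?thesis using Ls z m st'(4) by (auto simp: rejects_def)
  qed
  have G: "?st (Guess u l) \<le> ones z (?st (Start u)) s"
      "ones z (?st (Start u)) s < ?st (Guess u l) + W u l" if "u \<in> set tuples" for u
    using sub that by (auto simp: in_subclass_def)
  show "\<not> val n z (?L # Ls) ds"
  proof (cases "l = i")
    case False
    show ?thesis
    \<comment> \<open>The class of \<open>z\<close> is not the one being split; only child
      \<open>l\<close> overwrites it.\<close>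
    proof (rule not_valI[of l])
      fix j assume "j \<le> k" "j \<noteq> l"
      then show "\<not> val n z Ls (child_digits n ?L j ds)"
        using False l G W(3) by (intro step[of l j]) auto
    qed
  next
    case li: True
    show ?thesis
    proof (cases "ones z (?st (Start t)) s < ?st (Guess t i) + w")
      case True
      show ?thesis
      \<comment> \<open>\<open>z\<close> is in the lower half, which only child \<open>k\<close>
        drops.\<close>
      proof (rule not_valI[of k])
        fix j assume "j \<le> k" "j \<noteq> k"
        then show "\<not> val n z Ls (child_digits n ?L j ds)"
        proof (intro step[of i j])
          fix u assume u: "u \<in> set tuples"
          show "ones z (?st (Start u)) s \<in> {child (nvars n) ?L j ?st (Guess u i)..<
              child (nvars n) ?L j ?st (Guess u i) + W' u i}"
            using G[OF u] True li W \<open>j \<noteq> k\<close> by (cases "u = t") auto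
        qed (use li i in auto)
      qed
    next
      case False
      show ?thesis
      \<comment> \<open>\<open>z\<close> is in the upper half, which only child \<open>i\<close>
        drops: it occupies slot \<open>i\<close> in child \<open>k\<close> and slot \<open>j\<close>
        in every other child \<open>j\<close>.\<close>
      proof (rule not_valI[of i])
        fix j assume j: "j \<le> k" "j \<noteq> i"
        define m where "m = (if j = k then i else j)"
        show "\<not> val n z Ls (child_digits n ?L j ds)"
        proof (intro step[of m j])
          show "m < k" using i j by (auto simp: m_def)
          show "(if m = j then i else m) = l" using li j i by (auto simp: m_def)
        next
          fix u assume u: "u \<in> set tuples"
          have c: "child (nvars n) ?L j ?st (Guess u m) = ?st (Guess u i) + (if u = t then w else 0)"
            using j i by (auto simp: m_def)
          have "m < k" using i j by (auto simp: m_def)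
          show "ones z (?st (Start u)) s \<in> {child (nvars n) ?L j ?st (Guess u m)..<
              child (nvars n) ?L j ?st (Guess u m) + W' u m}"
          proof (cases "u = t")
            case True
            then show ?thesis using G[OF u] False li W(1) le(2)[OF \<open>m < k\<close>] unfolding c by auto
          next
            case ut: False
            have "W' u m = W u m" using W(3)[of u m] ut by simp
            then show ?thesis using G[OF u] ut li le(1)[OF ut \<open>m < k\<close>] unfolding c by auto
          qed
        qed
      qed
    qed
  qed
qed


section \<open>From single splits to the refinement of all classes\<close>

lemma rejects_cong:
  assumes "rejects n Ls s W" "\<And>t i. t \<in> set tuples \<Longrightarrow> i < k \<Longrightarrow> W' t i = W t i"
  shows "rejects n Ls s W'"
  using assms by (simp add: rejects_def in_subclass_def)

definition refine :: "nat \<Rightarrow> layer list" where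
  "refine w = concat (map (\<lambda>t. map (Split w t) [0..<k]) tuples)"

definition phase :: "nat \<Rightarrow> nat \<Rightarrow> layer list" where
  "phase G h = concat (map (\<lambda>g. refine (2 ^ g)) (rev [0..<G])) @ [Commit (2 ^ h)]"

definition layers :: "nat \<Rightarrow> layer list" where
  "layers n = concat (map (phase (levels n)) (rev [0..<levels n]))"

lemma distinct_enum: "distinct (enum D B)"
proof (rule card_distinct)
  have "set (enum D B) = {ds. set ds \<subseteq> {..<B} \<and> length ds = D}"
    using set_enum[of _ D B] by blast
  then show "card (set (enum D B)) = length (enum D B)"
    by (simp add: length_enum card_lists_length_eq)
qed

text \<open>When slot \<open>m\<close> of \<open>t\<close> is split, the uncertainty for any other
  tuple is the same in all slots, and for \<open>t\<close> it is \<open>w\<close> or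
  \<open>2 * w\<close>. This is the comparison of precisions that \<open>split_rejects\<close> asks
  for. Layers are prepended, hence the induction on \<open>m\<close> downwards from
  \<open>k\<close>.\<close>

lemma refine_tuple_rejects:
  assumes Ls: "rejects n Ls s (\<lambda>u l. if u \<in> insert t P then w else 2 * w)"
    and t: "t \<in> set tuples" "t \<notin> P" and s: "0 < s"
  shows "rejects n (map (Split w t) [0..<k] @ Ls) s (\<lambda>u l. if u \<in> P then w else 2 * w)"
proof -
  have "rejects n (map (Split w t) [m..<k] @ Ls) s
      (\<lambda>u l. if u \<in> P \<or> u = t \<and> l < m then w else 2 * w)" if "m \<le> k" for m
    using that
  proof (induction m rule: inc_induct)
    case base
    have "rejects n Ls s (\<lambda>u l. if u \<in> P \<or> u = t \<and> l < k then w else 2 * w)"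
      by (rule rejects_cong[OF Ls]) auto
    then show ?case by simp
  next
    case (step m)
    have "rejects n (Split w t m # map (Split w t) [Suc m..<k] @ Ls) s
      (\<lambda>u l. if u \<in> P \<or> u = t \<and> l < m then w else 2 * w)"
      by (rule split_rejects[OF step.IH t(1) step.hyps(2) s]) (use t in auto)
    then show ?case using step.hyps by (simp add: upt_conv_Cons)
  qed
  from this[of 0] show ?thesis by simp
qed

lemma refine_tuples_rejects:
  assumes "rejects n Ls s (\<lambda>u l. if u \<in> P \<union> set ts then w else 2 * w)"
    and "distinct ts" "set ts \<subseteq> set tuples" "P \<inter> set ts = {}" "0 < s"
  shows "rejects n (concat (map (\<lambda>t. map (Split w t) [0..<k]) ts) @ Ls) s
    (\<lambda>u l. if u \<in> P then w else 2 * w)"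
  using assms
proof (induction ts arbitrary: P)
  case (Cons t ts)
  have "rejects n (concat (map (\<lambda>t. map (Split w t) [0..<k]) ts) @ Ls) s
    (\<lambda>u l. if u \<in> insert t P then w else 2 * w)"
    by (rule Cons.IH) (use Cons.prems in auto)
  then show ?case
    using refine_tuple_rejects[of n "concat (map (\<lambda>t. map (Split w t) [0..<k]) ts) @ Ls" s t P w]
      Cons.prems by auto
qed simp

lemma refine_rejects:
  assumes "rejects n Ls s (\<lambda>_ _. w)" "0 < s"
  shows "rejects n (refine w @ Ls) s (\<lambda>_ _. 2 * w)"
proof -
  have "rejects n Ls s (\<lambda>u l. if u \<in> {} \<union> set tuples then w else 2 * w)"
    by (rule rejects_cong[OF assms(1)]) simp
  then show ?thesis
    using refine_tuples_rejects[of n Ls s "{}" tuples w] assms(2) distinct_enum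
    by (simp add: refine_def tuples_def)
qed

lemma refinements_reject:
  assumes "rejects n Ls s (\<lambda>_ _. 1)" "0 < s"
  shows "rejects n (concat (map (\<lambda>g. refine (2 ^ g)) (rev [0..<G])) @ Ls) s (\<lambda>_ _. 2 ^ G)"
proof (induction G)
  case (Suc G)
  from refine_rejects[OF this assms(2)] show ?case by simp
qed (use assms in simp)

section \<open>Rounds: halving the segments\<close>

definition reset :: "(key \<Rightarrow> nat) \<Rightarrow> bool" where
  "reset st \<longleftrightarrow> (\<forall>i < k. st (Parent i) = i \<and> (\<forall>t \<in> set tuples. st (Guess t i) = 0))"

definition rejects_reset :: "nat \<Rightarrow> layer list \<Rightarrow> nat \<Rightarrow> bool" where
  "rejects_reset n Ls len \<longleftrightarrow> (\<forall>ds z i. length z = nvars n \<longrightarrow> count_list z True \<le> n \<longrightarrow>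
     wf_state n len (state ds) \<longrightarrow> reset (state ds) \<longrightarrow> i < k \<longrightarrow>
     in_class (state ds) len i z \<longrightarrow> \<not> val n z Ls ds)"

text \<open>With uncertainty 1 the guesses are the exact counts for all members of a class. If the
  ones of the parties could cover the left half, the strict inequality for the whole segment passes
  to the right half.\<close>

lemma commit_rejects:
  assumes Ls: "rejects_reset n Ls s" and s: "0 < s"
  shows "rejects n (Commit s # Ls) s (\<lambda>_ _. 1)"
  unfolding rejects_def
proof (intro allI impI, rule not_valI)
  fix ds z i j
  let ?st = "state ds" and ?L = "Commit s"
  let ?st' = "state (child_digits n ?L j ds)"
  assume z: "length z = nvars n" "count_list z True \<le> n"
    and wf: "wf_state n (2 * s) ?st" and i: "i < k" and sub: "in_subclass ?st s (\<lambda>_ _. 1) i z"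
  have par: "parent ?st l = ?st (Parent l)" "parent ?st l < k" if "l < k" for l
    using wf that by (simp_all add: wf_state_def parent_def)
  have tup: "map (parent ?st) u \<in> set tuples" if "u \<in> set tuples" for u
    using that par(2) by (auto simp: tuples)
  have old: "?st (Start v) + 2 * s \<le> 2 ^ levels n" "l < k \<Longrightarrow> ?st (Bound v l) \<le> n"
      "(\<Sum>l\<leftarrow>v. ?st (Bound v l)) < min (nvars n - ?st (Start v)) (2 * s)"
    if "v \<in> set tuples" for v l
    using wf that by (auto simp: wf_state_def)
  have left: "?st' (Start u) = child (nvars n) ?L j ?st (Start u)" if "u \<in> set tuples" for u
    using old(1)[OF tup[OF that]] that s by (auto simp: state_child_digits keys base_def intro!: clip_id)
  have bound_le: "child (nvars n) ?L j ?st (Bound u l) \<le> n" if "u \<in> set tuples" "l < k" for u l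
    using old(2)[OF tup[OF that(1)] par(2)[OF that(2)]] by (auto simp: left_ones_def)
  have bound: "?st' (Bound u l) = child (nvars n) ?L j ?st (Bound u l)"
    if "u \<in> set tuples" "l < k" for u l
  proof -
    have "child (nvars n) ?L j ?st (Bound u l) < base n"
      using bound_le[OF that] n_less_base[of n] by linarith
    then show ?thesis using that by (simp only: state_child_digits keys clip_id)
  qed
  have reset: "reset ?st'"
    by (auto simp: reset_def state_child_digits keys clip_def base_def)
  have sum: "(\<Sum>l\<leftarrow>u. ?st' (Bound u l)) < min (nvars n - ?st' (Start u)) s" if u: "u \<in> set tuples" for u
  proof -
    let ?v = "map (parent ?st) u"
    have bd: "(\<Sum>l\<leftarrow>u. ?st' (Bound u l)) = (\<Sum>l\<leftarrow>u. child (nvars n) ?L j ?st (Bound u l))"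
    proof (intro arg_cong[of _ _ sum_list] map_cong refl)
      fix l assume "l \<in> set u"
      then have "l < k" using u by (auto simp: tuples)
      then show "?st' (Bound u l) = child (nvars n) ?L j ?st (Bound u l)" using bound u by simp
    qed
    show ?thesis
    proof (cases "go_left (nvars n) s ?st u")
      case True
      then show ?thesis unfolding bd left[OF u] by (simp add: go_left_def)
    next
      case False
      let ?r = "\<lambda>l. ?st (Bound ?v (parent ?st l)) - ?st (Guess ?v l)"
      have "(\<Sum>l\<leftarrow>u. left_ones ?st ?v l) + (\<Sum>l\<leftarrow>u. ?r l) = (\<Sum>l\<leftarrow>u. left_ones ?st ?v l + ?r l)"
        by (simp add: sum_list_addf)
      \<comment> \<open>\<open>min g b + (b - g) = b\<close> also for an inconsistent guess
        \<open>g > b\<close>.\<close>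
      also have "\<dots> = (\<Sum>l\<leftarrow>u. ?st (Bound ?v (parent ?st l)))"
        by (intro arg_cong[of _ _ sum_list] map_cong) (auto simp: left_ones_def)
      also have "\<dots> < min (nvars n - ?st (Start ?v)) (2 * s)"
        using old(3)[OF tup[OF u]] by (simp add: comp_def)
      finally have lt: "(\<Sum>l\<leftarrow>u. left_ones ?st ?v l) + (\<Sum>l\<leftarrow>u. ?r l)
        < min (nvars n - ?st (Start ?v)) (2 * s)" .
      \<comment> \<open>\<open>A\<close> cannot reach \<open>X\<close>, since even
        \<open>A + R\<close> is below it. So the test failed because \<open>A\<close> is at least
        \<open>s\<close>, and subtracting \<open>s\<close> gives both bounds on
        \<open>R\<close>.\<close>
      have arith: "R < min (X - s) s" if "\<not> A < min X s" "A + R < min X (2 * s)" for A R X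
        using that by arith
      from arith[OF False[unfolded go_left_def] lt] False show ?thesis
        unfolding bd left[OF u] by (simp add: diff_diff_left)
    qed
  qed
  have wf': "wf_state n s ?st'"
    using reset left bound bound_le sum old(1)[OF tup] s
    by (fastforce simp: wf_state_def reset_def)
  have "in_class ?st' s i z"
    unfolding in_class_def
  proof
    fix u assume u: "u \<in> set tuples"
    let ?v = "map (parent ?st) u"
    have "ones z (?st (Start ?v)) (2 * s) \<le> ?st (Bound ?v (parent ?st i))"
      using sub tup[OF u] par(1)[OF i] by (auto simp: in_subclass_def in_class_def)
    moreover have "ones z (?st (Start ?v)) s = ?st (Guess ?v i)"
      using sub tup[OF u] by (auto simp: in_subclass_def)
    ultimately show "ones z (?st' (Start u)) s \<le> ?st' (Bound u i)"
      using ones_add[of z "?st (Start ?v)" s s] unfolding left[OF u] bound[OF u i]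
      by (auto simp: left_ones_def mult_2)
  qed
  with Ls z wf' reset i show "\<not> val n z Ls (child_digits n ?L j ds)"
    by (auto simp: rejects_reset_def)
qed

text \<open>At the start of a round, guess 0 with uncertainty \<open>2 ^ levels n\<close> excludes
  nothing, because no input considered has that many ones.\<close>

lemma rejects_reset_start:
  assumes "rejects n Ls s (\<lambda>_ _. 2 ^ levels n)"
  shows "rejects_reset n Ls (2 * s)"
  unfolding rejects_reset_def
proof (intro allI impI)
  fix ds z i
  assume A: "length z = nvars n" "count_list z True \<le> n" "wf_state n (2 * s) (state ds)"
    "reset (state ds)" "i < k" "in_class (state ds) (2 * s) i z"
  have "ones z a s < 2 ^ levels n" for a
    using ones_le[of z a s] A(2) n_less[of n] nvars_less[of n] by linarith
  with A have "in_subclass (state ds) s (\<lambda>_ _. 2 ^ levels n) i z"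
    by (auto simp: in_subclass_def reset_def)
  with A assms show "\<not> val n z Ls ds" by (auto simp: rejects_def)
qed

lemma leaf_rejects: "rejects_reset n [] 1"
  unfolding rejects_reset_def
proof (intro allI impI)
  fix ds z i
  let ?st = "state ds" and ?t = "[0..<k]"
  assume A: "length z = nvars n" "count_list z True \<le> n" "wf_state n 1 ?st"
    "i < k" "in_class ?st 1 i z"
  have t: "?t \<in> set tuples" by (auto simp: tuples)
  then have "(\<Sum>i\<leftarrow>?t. ?st (Bound ?t i)) < min (nvars n - ?st (Start ?t)) 1"
    using A(3) unfolding wf_state_def by blast
  then have a: "?st (Start ?t) < nvars n" and "(\<Sum>i\<leftarrow>?t. ?st (Bound ?t i)) = 0"
    by auto
  then have "?st (Bound ?t i) = 0" using A(4) by (simp add: sum_list_eq_0_iff)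
  then have "ones z (?st (Start ?t)) 1 = 0"
    using A(5) t unfolding in_class_def by fastforce
  then show "\<not> val n z [] ds"
    using ones_0_1 a A(1) by (simp add: leaf_var_def clip_id)
qed

text \<open>The round with \<open>Commit (2 ^ h)\<close> handles segments of length
  \<open>2 ^ Suc h\<close>; the induction builds the layers up from the leaves.\<close>

lemma layers_reject: "rejects_reset n (layers n) (2 ^ levels n)"
proof -
  have "rejects_reset n (concat (map (phase (levels n)) (rev [0..<h]))) (2 ^ h)" for h
  proof (induction h)
    case (Suc h)
    have "rejects n (Commit (2 ^ h) # concat (map (phase (levels n)) (rev [0..<h]))) (2 ^ h) (\<lambda>_ _. 1)"
      by (rule commit_rejects[OF Suc]) simp
    from refinements_reject[OF this, of "levels n"] have
      "rejects n (phase (levels n) h @ concat (map (phase (levels n)) (rev [0..<h]))) (2 ^ h)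
         (\<lambda>_ _. 2 ^ levels n)"
      by (simp add: phase_def)
    from rejects_reset_start[OF this] show ?case by simp
  qed (use leaf_rejects in simp)
  then show ?thesis by (simp add: layers_def)
qed

section \<open>The initial state and the correctness of the values\<close>

fun init_digit :: "nat \<Rightarrow> key \<Rightarrow> nat" where
  "init_digit n (Start t) = 0"
| "init_digit n (Bound t i) = n"
| "init_digit n (Parent i) = i"
| "init_digit n (Guess t i) = 0"

definition init_digits :: "nat \<Rightarrow> nat list" where
  "init_digits n = map (init_digit n) keys"

text \<open>The number of variables enters here: the invariant starts as
  \<open>k * n < k * n + 1\<close>. With bound \<open>n\<close> every class contains all inputs
  concerned; class 0 is used.\<close>

lemma val_init_digits:
  assumes z: "length z = nvars n" "count_list z True \<le> n"
  shows "\<not> val n z (layers n) (init_digits n)"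
proof -
  let ?st = "state (init_digits n)"
  have st: "?st q = init_digit n q" if "q \<in> set keys" for q
    using that by (simp add: init_digits_def state_map)
  have "(\<Sum>i\<leftarrow>t. ?st (Bound t i)) = k * n" if "t \<in> set tuples" for t
  proof -
    have "?st (Bound t i) = n" if "i \<in> set t" for i
      using that \<open>t \<in> set tuples\<close> by (subst st) (auto simp: keys tuples)
    then have "(\<Sum>i\<leftarrow>t. ?st (Bound t i)) = (\<Sum>i\<leftarrow>t. n)"
      by (intro arg_cong[of _ _ sum_list] map_cong) auto
    then show ?thesis using that by (simp add: tuples sum_list_triv)
  qed
  then have "wf_state n (2 ^ levels n) ?st"
    using nvars_less[of n] by (auto simp: wf_state_def st keys nvars_def)
  moreover have "reset ?st" by (simp add: reset_def st keys)
  moreover have "in_class ?st (2 ^ levels n) 0 z"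
    using ones_le[of z] z(2) k_pos by (auto simp: in_class_def st keys intro: order_trans)
  ultimately show ?thesis
    using layers_reject[of n] z k_pos unfolding rejects_reset_def by blast
qed

lemma val_layers:
  assumes x: "length x = nvars n"
  shows "val n x (layers n) (init_digits n) \<longleftrightarrow> thr (n + 1) x"
proof (cases "count_list x True \<le> n")
  case True
  then show ?thesis using val_init_digits[OF x] by (simp add: thr_def)
next
  case False
  have "val n x (layers n) (init_digits n)"
  proof (rule ccontr)
    assume neg: "\<not> ?thesis"
    let ?Z = "{i. i < nvars n \<and> \<not> x ! i}"
    obtain f where f: "bij_betw f ?Z {0..<card ?Z}"
      using ex_bij_betw_finite_nat[of ?Z] by auto
    have "?Z = {..<nvars n} - {i. i < length x \<and> x ! i}" using x by auto
    then have "card ?Z = nvars n - count_list x True"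
      using x by (simp add: count_True_eq_card card_Diff_subset subset_eq)
    \<comment> \<open>At least \<open>n + 1\<close> of the \<open>k * n + 1\<close> positions are
      ones.\<close>
    then have card: "card ?Z \<le> (k - 1) * n"
      using False by (simp add: nvars_def diff_mult_distrib)
    \<comment> \<open>\<open>f\<close> numbers the zeros of \<open>x\<close>; the ones of
      \<open>y c\<close> are the zeros in the \<open>c\<close>-th block of \<open>n\<close>
      consecutive numbers.\<close>
    define y where "y c = map (\<lambda>i. \<not> x ! i \<and> f i div n = c) [0..<nvars n]" for c
    have y: "count_list (y c) True \<le> n" for c
    proof -
      let ?Y = "{i. i < length (y c) \<and> y c ! i}"
      have Y: "?Y \<subseteq> ?Z" by (auto simp: y_def)
      have "f ` ?Y \<subseteq> {c * n..<c * n + n}"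
      proof
        fix q assume "q \<in> f ` ?Y"
        then obtain i where i: "i \<in> ?Y" "q = f i" by auto
        then have "i \<in> ?Z" using Y by blast
        then have "f i < card ?Z" using bij_betwE[OF f] by auto
        \<comment> \<open>\<open>x\<close> has a zero here, which excludes \<open>n = 0\<close> and
          with it the default value of division by 0.\<close>
        then have "(k - 1) * n \<noteq> 0" using card by linarith
        then have "0 < n" by (cases n) auto
        moreover have "f i div n = c" using i by (auto simp: y_def)
        ultimately show "q \<in> {c * n..<c * n + n}"
          using i dividend_less_times_div[of n "f i"] by (auto simp: mult.commute)
      qed
      from card_mono[OF _ this] have "card (f ` ?Y) \<le> n" by simp
      moreover have "inj_on f ?Y" using f Y by (auto simp: bij_betw_def intro: inj_on_subset)
      ultimately show ?thesis by (simp add: card_image count_True_eq_card)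
    qed
    \<comment> \<open>Each zero of \<open>x\<close> is a one of some \<open>y c\<close>, so these at
      most \<open>k\<close> inputs have no common zero.\<close>
    let ?X = "insert x (y ` {..<k - 1})"
    have "card ?X \<le> k"
      using card_image_le[of "{..<k - 1}" y] k_pos card_insert_le_m1[of k "y ` {..<k - 1}" x] by simp
    moreover have "\<not> val n z (layers n) (init_digits n)" if "z \<in> ?X" for z
      using that neg val_init_digits[of _ n] y by (auto simp: y_def)
    ultimately obtain i where i: "i < nvars n" "\<forall>z \<in> ?X. \<not> z ! i"
      using val_common_zero[of ?X n "layers n" "init_digits n"] by auto
    then have "i \<in> ?Z" by auto
    then have "f i < (k - 1) * n" using bij_betwE[OF f] card by fastforce
    then have "f i div n < k - 1" by (simp add: less_mult_imp_div_less)
    then have "\<not> y (f i div n) ! i" using i by auto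
    then show False using i by (auto simp: y_def)
  qed
  then show ?thesis using False by (simp add: thr_def)
qed

section \<open>The circuit\<close>

definition width :: "nat \<Rightarrow> nat" where
  "width n = base n ^ length keys"

definition node :: "nat \<Rightarrow> nat \<Rightarrow> nat list \<Rightarrow> node" where
  "node n l ds = (if l < length (layers n)
     then Thr2 (map (\<lambda>j. Suc l * width n + enc (base n) (child_digits n (layers n ! l) j ds)) [0..<k + 1])
     else Var (leaf_var n ds))"

text \<open>Every layer lists all digit sequences, reachable or not, so that the index of a node is
  computed from its layer and digits alone.\<close>

definition circ :: "nat \<Rightarrow> circuit" where
  "circ n = \<lparr>nodes = concat (map (\<lambda>l. map (node n l) (enum (length keys) (base n))) [0..<Suc (length (layers n))]),
     out = enc (base n) (init_digits n)\<rparr>"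

lemma width_pos: "0 < width n"
  by (simp add: width_def base_def)

lemma length_nodes: "length (nodes (circ n)) = Suc (length (layers n)) * width n"
  unfolding circ_def circuit.simps by (rule length_concat_blocks) (simp add: length_enum width_def)

lemma nth_nodes:
  assumes "l \<le> length (layers n)" "c < width n"
  shows "nodes (circ n) ! (l * width n + c) = node n l (enum (length keys) (base n) ! c)"
proof -
  have "nodes (circ n) ! (l * width n + c) = map (node n l) (enum (length keys) (base n)) ! c"
    unfolding circ_def circuit.simps
    by (rule nth_concat_blocks) (use assms in \<open>auto simp: length_enum width_def\<close>)
  then show ?thesis using assms by (simp add: length_enum width_def)
qed

lemma enc_digits:
  assumes "length ds = length keys" "set ds \<subseteq> {..<base n}"
  shows "enc (base n) ds < width n" "enum (length keys) (base n) ! enc (base n) ds = ds"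
  using nth_enum[OF assms(2)] assms(1) by (simp_all add: width_def)

lemma child_digits_range:
  "length (child_digits n L j ds) = length keys" "set (child_digits n L j ds) \<subseteq> {..<base n}"
  by (auto simp: child_digits_def clip_def base_def)

lemma init_digits_range:
  "length (init_digits n) = length keys" "set (init_digits n) \<subseteq> {..<base n}"
proof -
  have "init_digit n q < base n" if "q \<in> set keys" for q
    by (rule key.exhaust[of q]) (use that n_less_base[of n] in \<open>auto simp: keys base_def\<close>)
  then show "length (init_digits n) = length keys" "set (init_digits n) \<subseteq> {..<base n}"
    by (auto simp: init_digits_def)
qed

lemma nodes_circ_cases:
  assumes "v < length (nodes (circ n))"
  obtains (gate) ds where "v div width n < length (layers n)"
      "nodes (circ n) ! v = Thr2 (map (\<lambda>j. Suc (v div width n) * width n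
         + enc (base n) (child_digits n (layers n ! (v div width n)) j ds)) [0..<k + 1])"
    | (leaf) ds where "v div width n = length (layers n)" "nodes (circ n) ! v = Var (leaf_var n ds)"
proof -
  let ?l = "v div width n" and ?ds = "enum (length keys) (base n) ! (v mod width n)"
  have l: "?l < Suc (length (layers n))"
    using assms by (simp only: length_nodes less_mult_imp_div_less)
  then have "nodes (circ n) ! (?l * width n + v mod width n) = node n ?l ?ds"
    using width_pos by (intro nth_nodes) auto
  then have "nodes (circ n) ! v = node n ?l ?ds" by (simp only: div_mult_mod_eq)
  then show ?thesis
    using that l by (cases "?l < length (layers n)") (auto simp: node_def)
qed

text \<open>Dividing an index by \<open>width n\<close> recovers the layer. That edges lead exactly
  one layer further gives both acyclicity and the depth bound.\<close>

lemma edges_circ: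
  assumes "(v, w) \<in> edges (circ n)"
  shows "w div width n = Suc (v div width n)" "v div width n < length (layers n)"
    "w < length (nodes (circ n))"
proof -
  from assms obtain ws where v: "v < length (nodes (circ n))"
    and ws: "nodes (circ n) ! v = Thr2 ws" "w \<in> set ws"
    by (auto simp: edges_def)
  from v have "w div width n = Suc (v div width n) \<and> v div width n < length (layers n)
    \<and> w < length (nodes (circ n))"
  proof (cases rule: nodes_circ_cases)
    case (gate ds)
    let ?l = "v div width n"
    from gate ws obtain j where w: "w = Suc ?l * width n
         + enc (base n) (child_digits n (layers n ! ?l) j ds)" by auto
    let ?c = "enc (base n) (child_digits n (layers n ! ?l) j ds)"
    have c: "?c < width n" by (rule enc_digits[OF child_digits_range])
    have "w div width n = Suc ?l + ?c div width n"
      unfolding w by (rule div_mult_self3) (use width_pos[of n] in simp)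
    then have d: "w div width n = Suc ?l" using c by simp
    have "w < Suc (Suc ?l) * width n" unfolding w using c by simp
    also have "\<dots> \<le> length (nodes (circ n))"
      unfolding length_nodes using gate(1) by (intro mult_le_mono1) simp
    finally show ?thesis using d gate(1) by simp
  qed (use ws in simp)
  then show "w div width n = Suc (v div width n)" "v div width n < length (layers n)"
    "w < length (nodes (circ n))" by auto
qed

lemma thr2_circuit_circ: "thr2_circuit (k + 1) (nvars n) (circ n)"
proof -
  have out: "out (circ n) < length (nodes (circ n))"
    using enc_digits(1)[OF init_digits_range[of n]] unfolding length_nodes by (simp add: circ_def)
  have "i < nvars n" if "Var i \<in> set (nodes (circ n))" for i
  proof -
    from that obtain v where v: "v < length (nodes (circ n))" "nodes (circ n) ! v = Var i"
      by (auto simp: in_set_conv_nth)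
    from v(1) show ?thesis
      by (cases rule: nodes_circ_cases) (use v(2) leaf_var_less in auto)
  qed
  moreover have "length ws = k + 1 \<and> (\<forall>w \<in> set ws. w < length (nodes (circ n)))"
    if "Thr2 ws \<in> set (nodes (circ n))" for ws
  proof -
    from that obtain v where v: "v < length (nodes (circ n))" "nodes (circ n) ! v = Thr2 ws"
      by (auto simp: in_set_conv_nth)
    from v(1) have "length ws = k + 1"
      by (cases rule: nodes_circ_cases) (use v(2) in auto)
    moreover have "w < length (nodes (circ n))" if "w \<in> set ws" for w
      by (rule edges_circ(3)[of v]) (use v that in \<open>auto simp: edges_def\<close>)
    ultimately show ?thesis by blast
  qed
  moreover have "edges (circ n) \<subseteq> less_than"
  proof
    fix e assume e: "e \<in> edges (circ n)"
    obtain v w where vw: "e = (v, w)" by (cases e)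
    have "\<not> w \<le> v"
      using edges_circ(1)[of v w n] e div_le_mono[of w v "width n"] by (auto simp: vw)
    then show "e \<in> less_than" by (simp add: vw)
  qed
  then have "acyclic (edges (circ n))"
    using acyclic_subset wf_acyclic wf_less_than by blast
  ultimately show ?thesis using out by (auto simp: thr2_circuit_def)
qed

text \<open>Paths that reach the same layer with the same digits share a node. This is sound because
  \<open>val\<close> depends only on the remaining layers and the digits.\<close>

lemma evaluates_circ:
  assumes x: "length x = nvars n"
    and "length ds = length keys" "set ds \<subseteq> {..<base n}" "l \<le> length (layers n)"
  shows "evaluates (circ n) x (l * width n + enc (base n) ds) (val n x (drop l (layers n)) ds)"
  using assms(4) assms(2,3)
proof (induction l arbitrary: ds rule: inc_induct)
  case base
  let ?v = "length (layers n) * width n + enc (base n) ds"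
  note ds = enc_digits[OF base]
  have "?v < length (nodes (circ n))" unfolding length_nodes using ds(1) by simp
  moreover have "nodes (circ n) ! ?v = Var (leaf_var n ds)"
    using nth_nodes[OF order_refl ds(1)] ds(2) by (simp add: node_def)
  ultimately have "evaluates (circ n) x ?v (x ! leaf_var n ds)"
    using x leaf_var_less by (intro evaluates_Var) auto
  then show ?case by simp
next
  case (step l)
  let ?v = "l * width n + enc (base n) ds" and ?L = "layers n ! l"
  note ds = enc_digits[OF step.prems]
  let ?w = "\<lambda>j. Suc l * width n + enc (base n) (child_digits n ?L j ds)"
  let ?b = "\<lambda>j. val n x (drop (Suc l) (layers n)) (child_digits n ?L j ds)"
  have "?v < Suc l * width n" using ds(1) by simp
  also have "\<dots> \<le> length (nodes (circ n))"
    unfolding length_nodes using step.hyps by (intro mult_le_mono1) simp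
  finally have "?v < length (nodes (circ n))" .
  moreover have "nodes (circ n) ! ?v = Thr2 (map ?w [0..<k + 1])"
    using nth_nodes[of l n, OF _ ds(1)] ds(2) step.hyps by (simp add: node_def)
  moreover have "list_all2 (evaluates (circ n) x) (map ?w [0..<k + 1]) (map ?b [0..<k + 1])"
    using step.IH child_digits_range by (simp add: list_all2_conv_all_nth del: upt_Suc)
  ultimately have "evaluates (circ n) x ?v (thr 2 (map ?b [0..<k + 1]))"
    by (rule evaluates_Thr2)
  moreover have "drop l (layers n) = ?L # drop (Suc l) (layers n)"
    using Cons_nth_drop_Suc[OF step.hyps(2)] by simp
  ultimately show ?case by (simp only: val.simps)
qed

lemma computes_circ: "computes (circ n) (nvars n) (thr (n + 1))"
  unfolding computes_def
proof (intro allI impI)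
  fix x :: "bool list" assume x: "length x = nvars n"
  show "evaluates (circ n) x (out (circ n)) (thr (n + 1) x)"
    using evaluates_circ[OF x init_digits_range, of 0] val_layers[OF x] by (simp add: circ_def)
qed

lemma depth_circ: "depth (circ n) \<le> length (layers n)"
proof -
  let ?D = "{d. \<exists>v \<in> input_nodes (circ n). (out (circ n), v) \<in> edges (circ n) ^^ d}"
  have level: "(u, v) \<in> edges (circ n) ^^ d \<Longrightarrow> v div width n = u div width n + d" for u v d
    by (induction d arbitrary: v) (auto dest: edges_circ(1))
  have "d \<le> length (layers n)" if "d \<in> ?D" for d
  proof -
    from that obtain v where v: "v < length (nodes (circ n))" "(out (circ n), v) \<in> edges (circ n) ^^ d"
      by (auto simp: input_nodes_def)
    have "v div width n < Suc (length (layers n))"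
      using v(1) by (simp only: length_nodes less_mult_imp_div_less)
    then show ?thesis using level[OF v(2)] by simp
  qed
  moreover have "finite ?D" by (rule depth_set_finite[OF thr2_circuit_circ])
  moreover have "?D \<noteq> {}"
    by (rule depth_set_nonempty[OF thr2_circuit_circ])
      (use thr2_circuit_circ in \<open>auto simp: thr2_circuit_def\<close>)
  ultimately show ?thesis by (simp add: depth_def)
qed

lemma length_refine: "length (refine w) = k ^ k * k"
  by (simp add: refine_def length_concat comp_def sum_list_triv tuples_def length_enum)

lemma length_phase: "length (phase G h) = G * (k ^ k * k) + 1"
  by (simp add: phase_def length_concat comp_def sum_list_triv length_refine)

lemma length_layers: "length (layers n) = levels n * (levels n * (k ^ k * k) + 1)"
  by (simp add: layers_def length_concat comp_def sum_list_triv length_phase)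

end

section \<open>Register programs\<close>

text \<open>Registers are used as a stack: before and after running \<open>c\<close>, only those below \<open>m\<close> and
  \<open>m'\<close>, respectively, have known contents, and the others are free for temporary values.\<close>

definition tr :: "nat \<Rightarrow> (nat \<Rightarrow> nat) \<Rightarrow> com \<Rightarrow> nat \<Rightarrow> (nat \<Rightarrow> nat) \<Rightarrow> nat list \<Rightarrow> nat \<Rightarrow> bool" where
  "tr m f c m' f' w T \<longleftrightarrow> (\<forall>s. (\<forall>r < m. reg s r = f r) \<longrightarrow>
     (\<exists>t s'. exec c s t s' \<and> t \<le> T \<and> (\<forall>r < m'. reg s' r = f' r) \<and> emitted s' = emitted s @ w))"

lemma trI:
  assumes "\<And>s :: ram. \<forall>r < m. reg s r = f r \<Longrightarrow>
    \<exists>t s'. exec c s t s' \<and> t \<le> T \<and> (\<forall>r < m'. reg s' r = f' r) \<and> emitted s' = emitted s @ w"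
  shows "tr m f c m' f' w T"
  using assms by (auto simp: tr_def)

lemma trE:
  assumes "tr m f c m' f' w T" "\<forall>r < m. reg s r = f r"
  obtains t s' where "exec c s t s'" "t \<le> T" "\<forall>r < m'. reg s' r = f' r" "emitted s' = emitted s @ w"
  using assms unfolding tr_def by blast

lemma tr_weaken:
  assumes "tr m f c m' f' w T" "m \<le> l" "\<And>r. r < m \<Longrightarrow> g r = f r"
    "l' \<le> m'" "\<And>r. r < l' \<Longrightarrow> g' r = f' r" "T \<le> T'" "w' = w"
  shows "tr l g c l' g' w' T'"
proof (rule trI)
  fix s :: ram assume "\<forall>r < l. reg s r = g r"
  then have "\<forall>r < m. reg s r = f r" using assms by simp
  from trE[OF assms(1) this] obtain t s' where "exec c s t s'" "t \<le> T"
    "\<forall>r < m'. reg s' r = f' r" "emitted s' = emitted s @ w" .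
  then show "\<exists>t s'. exec c s t s' \<and> t \<le> T' \<and> (\<forall>r < l'. reg s' r = g' r)
      \<and> emitted s' = emitted s @ w'"
    using assms by (intro exI[of _ t] exI[of _ s']) auto
qed

lemma tr_Seq:
  assumes "tr m f c m' f' w T" "tr m' f' c' m'' f'' w' T'"
  shows "tr m f (Seq c c') m'' f'' (w @ w') (T + T')"
proof (rule trI)
  fix s :: ram assume "\<forall>r < m. reg s r = f r"
  with assms(1) obtain t s' where 1: "exec c s t s'" "t \<le> T" "\<forall>r < m'. reg s' r = f' r"
      "emitted s' = emitted s @ w"
    by (rule trE)
  from assms(2) 1(3) obtain t' s'' where 2: "exec c' s' t' s''" "t' \<le> T'"
      "\<forall>r < m''. reg s'' r = f'' r" "emitted s'' = emitted s' @ w'"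
    by (rule trE)
  have "exec (Seq c c') s (t + t') s''" using 1 2 by (blast intro: exec_Seq)
  then show "\<exists>t s'. exec (Seq c c') s t s' \<and> t \<le> T + T' \<and> (\<forall>r < m''. reg s' r = f'' r)
      \<and> emitted s' = emitted s @ w @ w'"
    using 1 2 by (metis add_mono append.assoc)
qed

lemma tr_Const:
  assumes "\<And>x. x < m' \<Longrightarrow> (x = r \<or> x < m) \<and> g x = (f(r := c)) x"
  shows "tr m f (Const r c) m' g [] 1"
  by (rule trI, intro exI conjI, rule exec_Const) (use assms in auto)

lemma tr_Add:
  assumes "i < m" "j < m" "\<And>x. x < m' \<Longrightarrow> (x = r \<or> x < m) \<and> g x = (f(r := f i + f j)) x"
  shows "tr m f (Add r i j) m' g [] 1"
  by (rule trI, intro exI conjI, rule exec_Add) (use assms in auto)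

lemma tr_Sub:
  assumes "i < m" "j < m" "\<And>x. x < m' \<Longrightarrow> (x = r \<or> x < m) \<and> g x = (f(r := f i - f j)) x"
  shows "tr m f (Sub r i j) m' g [] 1"
  by (rule trI, intro exI conjI, rule exec_Sub) (use assms in auto)

lemma tr_Emit:
  assumes "r < m"
  shows "tr m f (Emit r) m f [f r] 1"
  by (rule trI, intro exI conjI, rule exec_Emit) (use assms in auto)

lemma tr_Ifnz:
  assumes "r < m" "f r \<noteq> 0 \<Longrightarrow> tr m f c m' f' w T" "f r = 0 \<Longrightarrow> tr m f c' m' f' w T"
  shows "tr m f (Ifnz r c c') m' f' w (Suc T)"
proof (rule trI)
  fix s :: ram assume s: "\<forall>r < m. reg s r = f r"
  show "\<exists>t s'. exec (Ifnz r c c') s t s' \<and> t \<le> Suc T \<and> (\<forall>r < m'. reg s' r = f' r)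
      \<and> emitted s' = emitted s @ w"
  proof (cases "f r = 0")
    case True
    from trE[OF assms(3)[OF True] s] obtain t s' where "exec c' s t s'" "t \<le> T"
      "\<forall>r < m'. reg s' r = f' r" "emitted s' = emitted s @ w" .
    then show ?thesis
      using True s assms(1) by (intro exI[of _ "Suc t"] exI[of _ s']) (auto intro: exec_Ifnz_False)
  next
    case False
    from trE[OF assms(2)[OF False] s] obtain t s' where "exec c s t s'" "t \<le> T"
      "\<forall>r < m'. reg s' r = f' r" "emitted s' = emitted s @ w" .
    then show ?thesis
      using False s assms(1) by (intro exI[of _ "Suc t"] exI[of _ s']) (auto intro: exec_Ifnz_True)
  qed
qed

text \<open>Register \<open>m\<close> counts up and \<open>Suc m\<close> holds the number of passes
  left. The latter is recomputed after each pass, so the body may use \<open>Suc m\<close> and all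
  higher registers as scratch space.\<close>

definition loop :: "nat \<Rightarrow> nat \<Rightarrow> com \<Rightarrow> com" where
  "loop m b c = Seq (Const m 0) (Seq (Sub (Suc m) b m) (Whilenz (Suc m)
     (Seq c (Seq (Const (Suc m) 1) (Seq (Add m m (Suc m)) (Sub (Suc m) b m))))))"

lemma tr_loop:
  assumes b: "b < m" "\<And>q. q \<le> B \<Longrightarrow> f q b = B"
    and c: "\<And>q. q < B \<Longrightarrow> tr (Suc m) ((f q)(m := q)) c (Suc m) ((f (Suc q))(m := q)) (w q) T"
  shows "tr m (f 0) (loop m b c) m (f B) (concat (map w [0..<B])) (3 + B * (T + 4))"
proof -
  let ?tail = "Seq (Const (Suc m) 1) (Seq (Add m m (Suc m)) (Sub (Suc m) b m))"
  let ?W = "Whilenz (Suc m) (Seq c ?tail)"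
  have body: "tr (Suc m) ((f q)(m := q)) (Seq c ?tail) (Suc (Suc m))
      ((f (Suc q))(m := Suc q, Suc m := B - Suc q)) (w q) (T + 3)" if "q < B" for q
  proof -
    let ?g = "f (Suc q)"
    have "tr (Suc m) (?g(m := q)) (Const (Suc m) 1) (Suc (Suc m)) (?g(m := q, Suc m := 1)) [] 1"
      by (rule tr_Const) auto
    moreover have "tr (Suc (Suc m)) (?g(m := q, Suc m := 1)) (Add m m (Suc m))
        (Suc (Suc m)) (?g(m := Suc q, Suc m := 1)) [] 1"
      by (rule tr_Add) auto
    moreover have "tr (Suc (Suc m)) (?g(m := Suc q, Suc m := 1)) (Sub (Suc m) b m)
        (Suc (Suc m)) (?g(m := Suc q, Suc m := B - Suc q)) [] 1"
      by (rule tr_Sub) (use b that in auto)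
    ultimately have "tr (Suc m) (?g(m := q)) ?tail (Suc (Suc m))
        (?g(m := Suc q, Suc m := B - Suc q)) ([] @ [] @ []) (1 + (1 + 1))"
      by (blast intro: tr_Seq)
    from tr_Seq[OF c[OF that] this] show ?thesis by (rule tr_weaken) auto
  qed
  have while: "\<exists>t s'. exec ?W s t s' \<and> t \<le> 1 + (B - q) * (T + 4) \<and> (\<forall>r < m. reg s' r = f B r)
      \<and> emitted s' = emitted s @ concat (map w [q..<B])"
    if "q \<le> B" "\<forall>r < Suc (Suc m). reg s r = ((f q)(m := q, Suc m := B - q)) r" for q s
    using that
  proof (induction q arbitrary: s rule: inc_induct)
    case base
    then have "exec ?W s 1 s" by (intro exec_Whilenz_False) simp
    then show ?case using base by (intro exI[of _ 1] exI[of _ s]) auto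
  next
    case (step q)
    then have "\<forall>r < Suc m. reg s r = ((f q)(m := q)) r" by auto
    from trE[OF body[OF \<open>q < B\<close>] this] obtain t s'
      where 1: "exec (Seq c ?tail) s t s'" "t \<le> T + 3"
        "\<forall>r < Suc (Suc m). reg s' r = ((f (Suc q))(m := Suc q, Suc m := B - Suc q)) r"
        "emitted s' = emitted s @ w q" .
    from step.IH[OF 1(3)] obtain t' s'' where 2: "exec ?W s' t' s''"
        "t' \<le> 1 + (B - Suc q) * (T + 4)" "\<forall>r < m. reg s'' r = f B r"
        "emitted s'' = emitted s' @ concat (map w [Suc q..<B])" by blast
    have "exec ?W s (Suc (t + t')) s''"
      using 1(1) 2(1) step.prems step.hyps by (intro exec_Whilenz_True) auto
    moreover have "B - q = Suc (B - Suc q)" using step.hyps by simp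
    then have "Suc (t + t') \<le> 1 + (B - q) * (T + 4)" using 1(2) 2(2) by simp
    moreover have "[q..<B] = q # [Suc q..<B]" using step.hyps by (simp add: upt_conv_Cons)
    ultimately show ?case using 1(4) 2(3,4) by (intro exI[of _ "Suc (t + t')"] exI[of _ s'']) simp
  qed
  have W: "tr (Suc (Suc m)) ((f 0)(m := 0, Suc m := B)) ?W m (f B) (concat (map w [0..<B])) (1 + B * (T + 4))"
    by (rule trI) (use while[of 0] in simp)
  have "tr m (f 0) (Const m 0) (Suc m) ((f 0)(m := 0)) [] 1" by (rule tr_Const) auto
  moreover have "tr (Suc m) ((f 0)(m := 0)) (Sub (Suc m) b m) (Suc (Suc m)) ((f 0)(m := 0, Suc m := B)) [] 1"
    by (rule tr_Sub) (use b in auto)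
  ultimately have "tr m (f 0) (loop m b c) m (f B) ([] @ [] @ concat (map w [0..<B])) (1 + (1 + (1 + B * (T + 4))))"
    unfolding loop_def using W by (blast intro: tr_Seq)
  then show ?thesis by (simp add: numeral_3_eq_3)
qed

section \<open>Compiling arithmetic expressions\<close>

datatype expr = Reg nat | Num nat | Plus expr expr | Minus expr expr | Cond expr expr expr

fun eval :: "(nat \<Rightarrow> nat) \<Rightarrow> expr \<Rightarrow> nat" where
  "eval f (Reg r) = f r"
| "eval f (Num c) = c"
| "eval f (Plus a b) = eval f a + eval f b"
| "eval f (Minus a b) = eval f a - eval f b"
| "eval f (Cond c a b) = (if eval f c \<noteq> 0 then eval f a else eval f b)"

fun below :: "nat \<Rightarrow> expr \<Rightarrow> bool" where
  "below m (Reg r) = (r < m)"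
| "below m (Num c) = True"
| "below m (Plus a b) = (below m a \<and> below m b)"
| "below m (Minus a b) = (below m a \<and> below m b)"
| "below m (Cond c a b) = (below m c \<and> below m a \<and> below m b)"

fun compile :: "expr \<Rightarrow> nat \<Rightarrow> com" where
  "compile (Reg r) m = Seq (Const m 0) (Add m r m)"
| "compile (Num c) m = Const m c"
| "compile (Plus a b) m = Seq (compile a m) (Seq (compile b (Suc m)) (Add m m (Suc m)))"
| "compile (Minus a b) m = Seq (compile a m) (Seq (compile b (Suc m)) (Sub m m (Suc m)))"
| "compile (Cond c a b) m = Seq (compile c m) (Ifnz m (compile a m) (compile b m))"

fun cost :: "expr \<Rightarrow> nat" where
  "cost (Reg r) = 2"
| "cost (Num c) = 1"
| "cost (Plus a b) = cost a + (cost b + 1)"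
| "cost (Minus a b) = cost a + (cost b + 1)"
| "cost (Cond c a b) = cost c + Suc (cost a + cost b)"

lemma eval_cong: "below m e \<Longrightarrow> (\<And>r. r < m \<Longrightarrow> f r = g r) \<Longrightarrow> eval f e = eval g e"
  by (induction e) auto

lemma below_mono: "below m e \<Longrightarrow> m \<le> m' \<Longrightarrow> below m' e"
  by (induction e) auto

lemma tr_compile:
  "below m e \<Longrightarrow> tr m f (compile e m) (Suc m) (f(m := eval f e)) [] (cost e)"
proof (induction e arbitrary: m f)
  case (Reg r)
  have "tr m f (Const m 0) (Suc m) (f(m := 0)) [] 1"
    by (rule tr_Const) auto
  moreover have "tr (Suc m) (f(m := 0)) (Add m r m) (Suc m) (f(m := f r)) [] 1"
    by (rule tr_Add) (use Reg in auto)
  ultimately have "tr m f (compile (Reg r) m) (Suc m) (f(m := f r)) ([] @ []) (1 + 1)"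
    unfolding compile.simps by (rule tr_Seq)
  then show ?case by (rule tr_weaken) auto
next
  case (Num c)
  show ?case unfolding compile.simps cost.simps eval.simps by (rule tr_Const) auto
next
  case (Plus a b)
  have a: "tr m f (compile a m) (Suc m) (f(m := eval f a)) [] (cost a)"
    by (rule Plus.IH(1)) (use Plus.prems in simp)
  have b: "eval (f(m := eval f a)) b = eval f b"
    using Plus.prems by (intro eval_cong[of m]) auto
  have "tr (Suc m) (f(m := eval f a)) (compile b (Suc m)) (Suc (Suc m))
      (f(m := eval f a, Suc m := eval f b)) [] (cost b)"
    unfolding b[symmetric] by (rule Plus.IH(2)) (use Plus.prems below_mono[of m b "Suc m"] in simp)
  moreover have "tr (Suc (Suc m)) (f(m := eval f a, Suc m := eval f b)) (Add m m (Suc m))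
      (Suc m) (f(m := eval f a + eval f b)) [] 1"
    by (rule tr_Add) auto
  ultimately have "tr m f (compile (Plus a b) m) (Suc m) (f(m := eval f a + eval f b))
      ([] @ [] @ []) (cost (Plus a b))"
    unfolding compile.simps cost.simps using a by (blast intro: tr_Seq)
  then show ?case by (rule tr_weaken) auto
next
  case (Minus a b)
  have a: "tr m f (compile a m) (Suc m) (f(m := eval f a)) [] (cost a)"
    by (rule Minus.IH(1)) (use Minus.prems in simp)
  have b: "eval (f(m := eval f a)) b = eval f b"
    using Minus.prems by (intro eval_cong[of m]) auto
  have "tr (Suc m) (f(m := eval f a)) (compile b (Suc m)) (Suc (Suc m))
      (f(m := eval f a, Suc m := eval f b)) [] (cost b)"
    unfolding b[symmetric] by (rule Minus.IH(2)) (use Minus.prems below_mono[of m b "Suc m"] in simp)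
  moreover have "tr (Suc (Suc m)) (f(m := eval f a, Suc m := eval f b)) (Sub m m (Suc m))
      (Suc m) (f(m := eval f a - eval f b)) [] 1"
    by (rule tr_Sub) auto
  ultimately have "tr m f (compile (Minus a b) m) (Suc m) (f(m := eval f a - eval f b))
      ([] @ [] @ []) (cost (Minus a b))"
    unfolding compile.simps cost.simps using a by (blast intro: tr_Seq)
  then show ?case by (rule tr_weaken) auto
next
  case (Cond c a b)
  let ?f = "f(m := eval f c)"
  have branch: "tr (Suc m) ?f (compile e m) (Suc m) (f(m := eval f e)) [] (cost a + cost b)"
    if "tr m f (compile e m) (Suc m) (f(m := eval f e)) [] (cost e)" "cost e \<le> cost a + cost b" for e
    by (rule tr_weaken[OF that(1)]) (use that(2) in auto)
  have a: "tr m f (compile a m) (Suc m) (f(m := eval f a)) [] (cost a)"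
    and b: "tr m f (compile b m) (Suc m) (f(m := eval f b)) [] (cost b)"
    and c: "tr m f (compile c m) (Suc m) ?f [] (cost c)"
    by (rule Cond.IH, use Cond.prems in simp)+
  have "tr (Suc m) ?f (Ifnz m (compile a m) (compile b m)) (Suc m) (f(m := eval f (Cond c a b)))
      [] (Suc (cost a + cost b))"
    by (rule tr_Ifnz) (use branch[OF a] branch[OF b] in auto)
  from tr_Seq[OF c this] show ?case unfolding compile.simps by (rule tr_weaken) auto
qed

definition assign :: "nat \<Rightarrow> expr \<Rightarrow> nat \<Rightarrow> com" where
  "assign r e m = Seq (compile e m) (Seq (Const (Suc m) 0) (Add r m (Suc m)))"

lemma tr_assign:
  assumes "below m e" "r < m"
  shows "tr m f (assign r e m) m (f(r := eval f e)) [] (cost e + 2)"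
proof -
  have "tr (Suc m) (f(m := eval f e)) (Const (Suc m) 0) (Suc (Suc m)) (f(m := eval f e, Suc m := 0)) [] 1"
    by (rule tr_Const) auto
  moreover have "tr (Suc (Suc m)) (f(m := eval f e, Suc m := 0)) (Add r m (Suc m)) m (f(r := eval f e)) [] 1"
    by (rule tr_Add) (use assms in auto)
  ultimately have "tr m f (assign r e m) m (f(r := eval f e)) ([] @ [] @ []) (cost e + (1 + 1))"
    unfolding assign_def using tr_compile[OF assms(1)] by (blast intro: tr_Seq)
  then show ?thesis by simp
qed

text \<open>The time is linear in the second factor only. Callers put the polynomially small base
  there and the growing code or power in \<open>i\<close>.\<close>

definition multiply :: "nat \<Rightarrow> nat \<Rightarrow> nat \<Rightarrow> com" where
  "multiply i j m = Seq (Const m 0) (loop (Suc m) j (Add m m i))"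

lemma tr_multiply:
  assumes "i < m" "j < m"
  shows "tr m f (multiply i j m) (Suc m) (f(m := f i * f j)) [] (4 + f j * 5)"
proof -
  let ?f = "\<lambda>q. f(m := q * f i)"
  have "tr (Suc m) (?f 0) (loop (Suc m) j (Add m m i)) (Suc m) (?f (f j))
      (concat (map (\<lambda>_. []) [0..<f j])) (3 + f j * (1 + 4))"
  proof (rule tr_loop)
    fix q
    show "tr (Suc (Suc m)) ((?f q)(Suc m := q)) (Add m m i) (Suc (Suc m)) ((?f (Suc q))(Suc m := q)) [] 1"
      by (rule tr_Add) (use assms in auto)
  qed (use assms in auto)
  then have "tr (Suc m) (f(m := 0)) (loop (Suc m) j (Add m m i)) (Suc m) (f(m := f i * f j)) [] (3 + f j * 5)"
    by (rule tr_weaken) (auto simp: mult.commute)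
  moreover have "tr m f (Const m 0) (Suc m) (f(m := 0)) [] 1"
    by (rule tr_Const) auto
  ultimately have "tr m f (multiply i j m) (Suc m) (f(m := f i * f j)) ([] @ []) (1 + (3 + f j * 5))"
    unfolding multiply_def by (blast intro: tr_Seq)
  then show ?thesis by simp
qed

definition power_of_two :: "expr \<Rightarrow> nat \<Rightarrow> com" where
  "power_of_two e m = Seq (Const m 1) (Seq (compile e (Suc m)) (loop (Suc (Suc m)) (Suc m) (Add m m m)))"

lemma tr_power_of_two:
  assumes "below m e"
  shows "tr m f (power_of_two e m) (Suc m) (f(m := 2 ^ eval f e)) [] (cost e + 4 + eval f e * 5)"
proof -
  let ?E = "eval f e"
  let ?f = "\<lambda>q. f(m := 2 ^ q, Suc m := ?E)"
  have "tr (Suc (Suc m)) (?f 0) (loop (Suc (Suc m)) (Suc m) (Add m m m)) (Suc (Suc m)) (?f ?E)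
      (concat (map (\<lambda>_. []) [0..<?E])) (3 + ?E * (1 + 4))"
  proof (rule tr_loop)
    fix q
    show "tr (Suc (Suc (Suc m))) ((?f q)(Suc (Suc m) := q)) (Add m m m) (Suc (Suc (Suc m)))
      ((?f (Suc q))(Suc (Suc m) := q)) [] 1"
      by (rule tr_Add) auto
  qed auto
  moreover have "tr (Suc m) (f(m := 1)) (compile e (Suc m)) (Suc (Suc m)) (?f 0) [] (cost e)"
    using tr_compile[OF below_mono[OF assms], of "Suc m" "f(m := 1)"]
      eval_cong[OF assms, of "f(m := 1)" f] by simp
  moreover have "tr m f (Const m 1) (Suc m) (f(m := 1)) [] 1"
    by (rule tr_Const) auto
  ultimately have "tr m f (power_of_two e m) (Suc (Suc m)) (?f ?E) ([] @ [] @ concat (map (\<lambda>_. []) [0..<?E]))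
      (1 + (cost e + (3 + ?E * (1 + 4))))"
    unfolding power_of_two_def by (blast intro: tr_Seq)
  then show ?thesis by (rule tr_weaken) auto
qed

text \<open>The number of loops is fixed by the program text. Their counters, in registers
  \<open>m\<close> to \<open>m + D - 1\<close>, are themselves the digits of the current
  sequence.\<close>

fun nest :: "nat \<Rightarrow> nat \<Rightarrow> nat \<Rightarrow> com \<Rightarrow> com" where
  "nest 0 m b c = c"
| "nest (Suc D) m b c = loop m b (nest D (Suc m) b c)"

fun nest_cost :: "nat \<Rightarrow> nat \<Rightarrow> nat \<Rightarrow> nat" where
  "nest_cost 0 B T = T"
| "nest_cost (Suc D) B T = 3 + B * (nest_cost D B T + 4)"

definition put :: "(nat \<Rightarrow> nat) \<Rightarrow> nat \<Rightarrow> nat list \<Rightarrow> nat \<Rightarrow> nat" where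
  "put f m ds r = (if m \<le> r \<and> r < m + length ds then ds ! (r - m) else f r)"

lemma put_Cons: "put (f(m := d)) (Suc m) ds = put f m (d # ds)"
  by (auto simp: put_def fun_eq_iff nth_Cons' not_less_eq_eq)

lemma concat_map_concat: "concat (map w (concat xss)) = concat (map (\<lambda>xs. concat (map w xs)) xss)"
  by (induction xss) auto

lemma tr_nest:
  assumes "b < m" "f b = B"
    and "\<And>ds. length ds = D \<Longrightarrow> set ds \<subseteq> {..<B} \<Longrightarrow> tr (m + D) (put f m ds) c (m + D) (put f m ds) (w ds) T"
  shows "tr m f (nest D m b c) m f (concat (map w (enum D B))) (nest_cost D B T)"
  using assms
proof (induction D arbitrary: m f w)
  case 0
  have "put f m [] = f" by (auto simp: put_def)
  then show ?case using 0(3)[of "[]"] by simp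
next
  case (Suc D)
  have "tr (Suc m) (f(m := q)) (nest D (Suc m) b c) (Suc m) (f(m := q))
      (concat (map (\<lambda>ds. w (q # ds)) (enum D B))) (nest_cost D B T)" if "q < B" for q
  proof (rule Suc.IH)
    fix ds assume "length ds = D" "set ds \<subseteq> {..<B}"
    then show "tr (Suc m + D) (put (f(m := q)) (Suc m) ds) c (Suc m + D) (put (f(m := q)) (Suc m) ds)
        (w (q # ds)) T"
      using Suc.prems(3)[of "q # ds"] that unfolding put_Cons by simp
  qed (use Suc.prems in auto)
  then have "tr m f (loop m b (nest D (Suc m) b c)) m f
      (concat (map (\<lambda>q. concat (map (\<lambda>ds. w (q # ds)) (enum D B))) [0..<B]))
      (3 + B * (nest_cost D B T + 4))"
    using tr_loop[of b m B "\<lambda>_. f" "nest D (Suc m) b c"] Suc.prems by simp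
  moreover have "concat (map w (enum (Suc D) B))
      = concat (map (\<lambda>q. concat (map (\<lambda>ds. w (q # ds)) (enum D B))) [0..<B])"
    by (simp add: concat_map_concat comp_def)
  ultimately show ?case by simp
qed

text \<open>\<open>Const m 0\<close> acts as an empty command: it only touches a free
  register.\<close>

fun seqs :: "nat \<Rightarrow> com list \<Rightarrow> com" where
  "seqs m [] = Const m 0"
| "seqs m (c # cs) = Seq c (seqs m cs)"

lemma tr_seqs:
  assumes "\<And>i. i < length xs \<Longrightarrow> tr m (f i) (g (xs ! i)) m (f (Suc i)) (w i) (T (xs ! i))"
  shows "tr m (f 0) (seqs m (map g xs)) m (f (length xs)) (concat (map w [0..<length xs])) (1 + (\<Sum>x\<leftarrow>xs. T x))"
  using assms
proof (induction xs arbitrary: f w)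
  case Nil
  have "tr m (f 0) (Const m 0) m (f 0) [] 1" by (rule tr_Const) auto
  then show ?case by simp
next
  case (Cons x xs)
  have "tr m (f 0) (g x) m (f 1) (w 0) (T x)" using Cons.prems[of 0] by simp
  moreover have "tr m (f 1) (seqs m (map g xs)) m (f (Suc (length xs)))
      (concat (map (\<lambda>i. w (Suc i)) [0..<length xs])) (1 + (\<Sum>x\<leftarrow>xs. T x))"
    using Cons.IH[of "\<lambda>i. f (Suc i)" "\<lambda>i. w (Suc i)"] Cons.prems[of "Suc _"] by simp
  ultimately have "tr m (f 0) (seqs m (map g (x # xs))) m (f (Suc (length xs)))
      (w 0 @ concat (map (\<lambda>i. w (Suc i)) [0..<length xs])) (T x + (1 + (\<Sum>x\<leftarrow>xs. T x)))"
    unfolding list.map seqs.simps by (rule tr_Seq)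
  then show ?case by (rule tr_weaken) (auto simp: map_upt_Suc simp del: upt_Suc)
qed

lemma enc_snoc: "enc B (ds @ [d]) = enc B ds * B + d"
  by (induction ds) (simp_all add: algebra_simps)

definition horner :: "nat \<Rightarrow> expr list \<Rightarrow> nat \<Rightarrow> com" where
  "horner b es m = Seq (Const m 0) (seqs (Suc m) (map (\<lambda>e. Seq (compile e (Suc m))
     (Seq (multiply m b (Suc (Suc m))) (Add m (Suc (Suc m)) (Suc m)))) es))"

definition horner_cost :: "expr list \<Rightarrow> nat \<Rightarrow> nat" where
  "horner_cost es B = 2 + (\<Sum>e\<leftarrow>es. cost e + (5 + B * 5))"

lemma tr_horner:
  assumes "b < m" "\<And>e. e \<in> set es \<Longrightarrow> below m e"
  shows "tr m f (horner b es m) (Suc m) (f(m := enc (f b) (map (eval f) es))) [] (horner_cost es (f b))"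
proof -
  let ?g = "\<lambda>i. f(m := enc (f b) (map (eval f) (take i es)))"
  let ?c = "\<lambda>e. Seq (compile e (Suc m)) (Seq (multiply m b (Suc (Suc m))) (Add m (Suc (Suc m)) (Suc m)))"
  have "tr (Suc m) (?g i) (?c (es ! i)) (Suc m) (?g (Suc i)) [] (cost (es ! i) + (5 + f b * 5))"
    if i: "i < length es" for i
  proof -
    let ?e = "es ! i"
    have e: "below m ?e" using assms(2) i by simp
    have "tr (Suc m) (?g i) (compile ?e (Suc m)) (Suc (Suc m)) ((?g i)(Suc m := eval f ?e)) [] (cost ?e)"
      using tr_compile[OF below_mono[OF e, of "Suc m"], of "?g i"] eval_cong[OF e, of "?g i" f] by simp
    moreover have "tr (Suc (Suc m)) ((?g i)(Suc m := eval f ?e)) (multiply m b (Suc (Suc m))) (Suc (Suc (Suc m)))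
        ((?g i)(Suc m := eval f ?e, Suc (Suc m) := enc (f b) (map (eval f) (take i es)) * f b)) []
        (4 + f b * 5)"
      by (rule tr_weaken[OF tr_multiply]) (use assms in auto)
    moreover have "tr (Suc (Suc (Suc m)))
        ((?g i)(Suc m := eval f ?e, Suc (Suc m) := enc (f b) (map (eval f) (take i es)) * f b))
        (Add m (Suc (Suc m)) (Suc m)) (Suc m) (?g (Suc i)) [] 1"
      by (rule tr_Add) (use i in \<open>auto simp: take_Suc_conv_app_nth enc_snoc\<close>)
    ultimately have "tr (Suc m) (?g i) (?c ?e) (Suc m) (?g (Suc i)) ([] @ [] @ [])
        (cost ?e + ((4 + f b * 5) + 1))"
      by (blast intro: tr_Seq)
    then show ?thesis by (rule tr_weaken) auto
  qed
  then have "tr (Suc m) (?g 0) (seqs (Suc m) (map ?c es)) (Suc m) (?g (length es))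
      (concat (map (\<lambda>_. []) [0..<length es])) (1 + (\<Sum>e\<leftarrow>es. cost e + (5 + f b * 5)))"
    by (rule tr_seqs)
  moreover have "tr m f (Const m 0) (Suc m) (?g 0) [] 1" by (rule tr_Const) auto
  ultimately have "tr m f (horner b es m) (Suc m) (?g (length es)) ([] @ concat (map (\<lambda>_. []) [0..<length es]))
      (1 + (1 + (\<Sum>e\<leftarrow>es. cost e + (5 + f b * 5))))"
    unfolding horner_def by (blast intro: tr_Seq)
  then show ?thesis by (rule tr_weaken) (auto simp: horner_cost_def)
qed

definition emit_code :: "nat \<Rightarrow> nat \<Rightarrow> expr list \<Rightarrow> nat \<Rightarrow> com" where
  "emit_code b r es m = Seq (horner b es m) (Seq (Add m r m) (Emit m))"

lemma tr_emit_code: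
  assumes "b < m" "r < m" "\<And>e. e \<in> set es \<Longrightarrow> below m e"
  shows "tr m f (emit_code b r es m) m f [f r + enc (f b) (map (eval f) es)] (horner_cost es (f b) + 2)"
proof -
  let ?v = "enc (f b) (map (eval f) es)"
  have "tr (Suc m) (f(m := ?v)) (Add m r m) (Suc m) (f(m := f r + ?v)) [] 1"
    by (rule tr_Add) (use assms in auto)
  moreover have "tr (Suc m) (f(m := f r + ?v)) (Emit m) m f [f r + ?v] 1"
    by (rule tr_weaken[OF tr_Emit[of m "Suc m" "f(m := f r + ?v)"]]) auto
  ultimately have "tr m f (emit_code b r es m) m f ([] @ [] @ [f r + ?v]) (horner_cost es (f b) + (1 + 1))"
    unfolding emit_code_def using tr_horner[OF assms(1,3)] by (blast intro: tr_Seq)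
  then show ?thesis by simp
qed

definition emit_num :: "nat \<Rightarrow> nat \<Rightarrow> com" where
  "emit_num c m = Seq (Const m c) (Emit m)"

lemma tr_emit_num: "tr m f (emit_num c m) m f [c] 2"
proof -
  have "tr m f (Const m c) (Suc m) (f(m := c)) [] 1" by (rule tr_Const) auto
  moreover have "tr (Suc m) (f(m := c)) (Emit m) m f [c] 1"
    by (rule tr_weaken[OF tr_Emit[of m "Suc m" "f(m := c)"]]) auto
  ultimately have "tr m f (emit_num c m) m f ([] @ [c]) (1 + 1)"
    unfolding emit_num_def by (rule tr_Seq)
  then show ?thesis by (rule tr_weaken) auto
qed

section \<open>Derived expressions and lookups at computed indices\<close>

definition minE :: "expr \<Rightarrow> expr \<Rightarrow> expr" where
  "minE a b = Minus a (Minus a b)"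

definition sumE :: "expr list \<Rightarrow> expr" where
  "sumE es = foldr Plus es (Num 0)"

definition clipE :: "nat \<Rightarrow> expr \<Rightarrow> expr" where
  "clipE r e = Cond (Minus (Reg r) e) e (Num 0)"

lemma minE [simp]:
  "eval f (minE a b) = min (eval f a) (eval f b)" "below m (minE a b) \<longleftrightarrow> below m a \<and> below m b"
  by (auto simp: minE_def)

lemma sumE [simp]:
  "eval f (sumE es) = (\<Sum>e\<leftarrow>es. eval f e)" "below m (sumE es) \<longleftrightarrow> (\<forall>e \<in> set es. below m e)"
  by (induction es) (auto simp: sumE_def)

text \<open>Register names are fixed in the program, so a lookup at a computed index becomes a chain
  of equality tests: the sum of both truncated differences is nonzero iff \<open>x\<close> differs
  from \<open>v\<close>. Values out of range end in \<open>F 0\<close>.\<close>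

fun caseE :: "nat \<Rightarrow> expr \<Rightarrow> (nat \<Rightarrow> expr) \<Rightarrow> expr" where
  "caseE 0 x F = F 0"
| "caseE (Suc v) x F = Cond (Plus (Minus x (Num v)) (Minus (Num v) x)) (caseE v x F) (F v)"

fun casesE :: "nat \<Rightarrow> expr list \<Rightarrow> (nat list \<Rightarrow> expr) \<Rightarrow> expr" where
  "casesE v [] F = F []"
| "casesE v (x # xs) F = caseE v x (\<lambda>p. casesE v xs (\<lambda>ps. F (p # ps)))"

lemma eval_caseE: "eval f (caseE v x F) = eval f (F (if eval f x < v then eval f x else 0))"
  by (induction v) (auto simp: less_Suc_eq)

lemma eval_casesE:
  "eval f (casesE v xs F) = eval f (F (map (\<lambda>x. if eval f x < v then eval f x else 0) xs))"
  by (induction xs arbitrary: F) (auto simp: eval_caseE)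

lemma below_caseE:
  assumes "below m x" "0 < v" "\<And>p. p < v \<Longrightarrow> below m (F p)"
  shows "below m (caseE v x F)"
proof -
  have "below m (caseE u x F)" if "u \<le> v" for u
    using that assms by (induction u) auto
  then show ?thesis by simp
qed

lemma below_casesE:
  assumes "0 < v" "\<And>x. x \<in> set xs \<Longrightarrow> below m x"
    "\<And>ps. length ps = length xs \<Longrightarrow> set ps \<subseteq> {..<v} \<Longrightarrow> below m (F ps)"
  shows "below m (casesE v xs F)"
  using assms(2,3)
proof (induction xs arbitrary: F)
  case (Cons x xs)
  show ?case
    unfolding casesE.simps
  proof (rule below_caseE)
    fix p assume "p < v"
    then show "below m (casesE v xs (\<lambda>ps. F (p # ps)))"
      by (intro Cons.IH) (use Cons.prems in auto)
  qed (use Cons.prems assms(1) in auto)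
qed simp

section \<open>The generator\<close>

context arity begin

text \<open>Register conventions: 0 to 4 hold \<open>n\<close>, \<open>nvars n\<close>, \<open>levels n\<close>, \<open>base n\<close> and \<open>width n\<close>;
  5 holds the index of the first node of the next layer, 6 and 8 the loop counters, 7 and 9 the
  parameters of \<open>Commit\<close> and \<open>Split\<close> layers; the digits of the current node start at 10.\<close>

definition env :: "nat \<Rightarrow> (nat \<Rightarrow> nat) \<Rightarrow> bool" where
  "env n f \<longleftrightarrow> f 0 = n \<and> f 1 = nvars n \<and> f 2 = levels n \<and> f 3 = base n \<and> f 4 = width n"

definition digit :: "key \<Rightarrow> expr" where
  "digit q = Reg (10 + pos keys q)"

abbreviation scratch :: nat where
  "scratch \<equiv> 10 + length keys"

lemma below_digit: "q \<in> set keys \<Longrightarrow> below scratch (digit q)"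
  using pos[of q keys] by (simp add: digit_def)

lemma eval_digit:
  "q \<in> set keys \<Longrightarrow> length ds = length keys \<Longrightarrow> eval (put f 10 ds) (digit q) = state ds q"
  using pos[of q keys] by (simp add: digit_def put_def state_def)

lemma eval_clipE: "eval f (clipE r e) = clip (f r) (eval f e)"
  by (simp add: clipE_def clip_def)

text \<open>\<open>t\<close>, \<open>i\<close> and \<open>j\<close> are known when the program is
  built, so the conditionals leave no test at run time. Only the weight varies; it is read from
  register 9.\<close>

fun split_expr :: "nat list \<Rightarrow> nat \<Rightarrow> nat \<Rightarrow> key \<Rightarrow> expr" where
  "split_expr t i j (Start u) = digit (Start u)"
| "split_expr t i j (Bound u l) = digit (Bound u l)"
| "split_expr t i j (Parent l) = digit (Parent (if l = j then i else l))"
| "split_expr t i j (Guess u l) = Plus (digit (Guess u (if l = j then i else l)))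
     (if u = t \<and> (j \<noteq> i \<and> l = j \<or> j = k \<and> l = i) then Reg 9 else Num 0)"

definition parents :: "expr list" where
  "parents = map (\<lambda>i. digit (Parent i)) [0..<k]"

definition left_ones_expr :: "nat list \<Rightarrow> nat list \<Rightarrow> nat \<Rightarrow> expr" where
  "left_ones_expr ps t l = minE (digit (Guess t l)) (digit (Bound t (ps ! l)))"

definition go_left_expr :: "nat list \<Rightarrow> nat list \<Rightarrow> expr" where
  "go_left_expr ps u = (let t = map ((!) ps) u in
     Minus (minE (Minus (Reg 1) (digit (Start t))) (Reg 7)) (sumE (map (left_ones_expr ps t) u)))"

text \<open>Which digits are needed depends on the parents, which are digits themselves. Hence a
  run-time case distinction over all \<open>k ^ k\<close> tuples of parents, each branch using fixed
  registers.\<close>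

fun commit_expr :: "key \<Rightarrow> expr" where
  "commit_expr (Start u) = casesE k parents (\<lambda>ps.
     Plus (digit (Start (map ((!) ps) u))) (Cond (go_left_expr ps u) (Num 0) (Reg 7)))"
| "commit_expr (Bound u l) = casesE k parents (\<lambda>ps. let t = map ((!) ps) u in
     Cond (go_left_expr ps u) (left_ones_expr ps t l)
       (Minus (digit (Bound t (ps ! l))) (digit (Guess t l))))"
| "commit_expr (Parent l) = Num l"
| "commit_expr (Guess u l) = Num 0"

lemma split_expr:
  assumes "q \<in> set keys" "i < k"
  shows "below scratch (split_expr t i j q)"
    and "length ds = length keys \<Longrightarrow> eval (put f 10 ds) (split_expr t i j q)
      = child N (Split (f 9) t i) j (state ds) q"
proof -
  show "below scratch (split_expr t i j q)"
    by (rule key.exhaust[of q]) (use assms in \<open>auto simp: keys intro!: below_digit\<close>)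
  show "eval (put f 10 ds) (split_expr t i j q) = child N (Split (f 9) t i) j (state ds) q"
    if "length ds = length keys"
    by (rule key.exhaust[of q]) (use assms that in \<open>auto simp: keys eval_digit put_def\<close>)
qed

lemma map_nth_tuple:
  assumes "length ps = k" "set ps \<subseteq> {..<k}" "u \<in> set tuples"
  shows "map ((!) ps) u \<in> set tuples"
proof -
  have "ps ! i < k" if "i \<in> set u" for i
  proof -
    have "i < length ps" using assms that by (auto simp: tuples)
    then show ?thesis using assms(2) nth_mem by blast
  qed
  then show ?thesis using assms(3) by (auto simp: tuples)
qed

lemma commit_below:
  assumes "q \<in> set keys"
  shows "below scratch (commit_expr q)"
proof -
  have cases: "below scratch (casesE k parents F)"
    if "\<And>ps. length ps = k \<Longrightarrow> set ps \<subseteq> {..<k} \<Longrightarrow> below scratch (F ps)" for F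
    by (rule below_casesE) (use that k_pos in \<open>auto simp: parents_def keys intro!: below_digit\<close>)
  have nth: "ps ! i < k" if "length ps = k" "set ps \<subseteq> {..<k}" "i < k" for ps i
    using that nth_mem by blast
  have lones: "below scratch (left_ones_expr ps t l)"
    if "length ps = k" "set ps \<subseteq> {..<k}" "t \<in> set tuples" "l < k" for ps t l
    unfolding left_ones_expr_def minE using that nth[OF that(1,2,4)]
    by (intro conjI below_digit) (simp_all add: keys)
  have left: "below scratch (go_left_expr ps u)"
    if ps: "length ps = k" "set ps \<subseteq> {..<k}" and u: "u \<in> set tuples" for ps u
  proof -
    have "\<forall>l \<in> set u. l < k" using u by (auto simp: tuples)
    then show ?thesis
      using map_nth_tuple[OF ps u] lones[OF ps]
      by (auto simp: go_left_expr_def Let_def keys intro!: below_digit)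
  qed
  show ?thesis
  proof (cases q)
    case (Start u)
    then have u: "u \<in> set tuples" using assms by (simp add: keys)
    show ?thesis
      unfolding Start commit_expr.simps
    proof (rule cases)
      fix ps assume ps: "length ps = k" "set ps \<subseteq> {..<k}"
      show "below scratch (Plus (digit (Start (map ((!) ps) u))) (Cond (go_left_expr ps u) (Num 0) (Reg 7)))"
        using left[OF ps u] map_nth_tuple[OF ps u] by (simp add: below_digit keys)
    qed
  next
    case (Bound u l)
    then have u: "u \<in> set tuples" and l: "l < k" using assms by (simp_all add: keys)
    show ?thesis
      unfolding Bound commit_expr.simps Let_def
    proof (rule cases)
      fix ps assume ps: "length ps = k" "set ps \<subseteq> {..<k}"
      let ?t = "map ((!) ps) u"
      have "below scratch (left_ones_expr ps ?t l)"
        by (rule lones[OF ps map_nth_tuple[OF ps u] l])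
      then show "below scratch (Cond (go_left_expr ps u) (left_ones_expr ps ?t l)
          (Minus (digit (Bound ?t (ps ! l))) (digit (Guess ?t l))))"
        using left[OF ps u] map_nth_tuple[OF ps u] nth[OF ps l] l by (simp add: below_digit keys)
    qed
  qed simp_all
qed

lemma commit_eval:
  assumes "q \<in> set keys" "length ds = length keys"
    and f: "f 1 = N"
  shows "eval (put f 10 ds) (commit_expr q) = child N (Commit (f 7)) j (state ds) q"
proof -
  let ?f = "put f 10 ds" and ?st = "state ds"
  let ?ps = "map (parent ?st) [0..<k]"
  have ps: "map (\<lambda>x. if eval ?f x < k then eval ?f x else 0) parents = ?ps"
    using assms(2) by (auto simp: parents_def parent_def eval_digit keys)
  have len: "length ?ps = k" "set ?ps \<subseteq> {..<k}"
    using k_pos by (auto simp: parent_def)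
  have map: "map ((!) ?ps) u = map (parent ?st) u" if "u \<in> set tuples" for u
    using that by (auto simp: tuples)
  have lones: "eval ?f (left_ones_expr ?ps t l) = left_ones ?st t l" if "t \<in> set tuples" "l < k" for t l
    using that assms(2) k_pos
    by (simp add: left_ones_expr_def left_ones_def eval_digit keys parent_def)
  have left: "eval ?f (go_left_expr ?ps u) \<noteq> 0 \<longleftrightarrow> go_left N (f 7) ?st u" if u: "u \<in> set tuples" for u
  proof -
    let ?t = "map (parent ?st) u"
    have t: "?t \<in> set tuples" using map_nth_tuple[OF len u] unfolding map[OF u] .
    have "(\<Sum>l\<leftarrow>u. eval ?f (left_ones_expr ?ps ?t l)) = sum_list (map (left_ones ?st ?t) u)"
      using u by (intro arg_cong[of _ _ sum_list] map_cong refl lones[OF t]) (auto simp: tuples)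
    then show ?thesis
      using t f assms(2) unfolding go_left_expr_def Let_def map[OF u]
      by (simp add: go_left_def eval_digit keys comp_def put_def not_le)
  qed
  show ?thesis
  proof (cases q)
    case (Start u)
    then have u: "u \<in> set tuples" using assms(1) by (simp add: keys)
    then show ?thesis
      using left[OF u] map_nth_tuple[OF len u] assms(2) unfolding Start
      by (simp add: eval_casesE ps map eval_digit keys put_def)
  next
    case (Bound u l)
    then have u: "u \<in> set tuples" "l < k" using assms(1) by (simp_all add: keys)
    moreover have "parent ?st l < k" using k_pos by (simp add: parent_def)
    ultimately show ?thesis
      using left[OF u(1)] map_nth_tuple[OF len u(1)] assms(2) unfolding Bound
      by (simp add: eval_casesE ps Let_def map lones eval_digit keys)
  qed simp_all
qed

section \<open>Writing one layer\<close>

definition gate_com :: "(nat \<Rightarrow> key \<Rightarrow> expr) \<Rightarrow> com" where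
  "gate_com E = Seq (emit_num 1 scratch) (Seq (emit_num (k + 1) scratch) (seqs scratch
     (map (\<lambda>j. emit_code 3 5 (map (\<lambda>q. clipE 3 (E j q)) keys) scratch) [0..<k + 1])))"

definition gate_cost :: "(nat \<Rightarrow> key \<Rightarrow> expr) \<Rightarrow> nat \<Rightarrow> nat" where
  "gate_cost E B = 5 + (\<Sum>j\<leftarrow>[0..<k + 1]. horner_cost (map (\<lambda>q. clipE 3 (E j q)) keys) B + 2)"

definition layer_com :: "(nat \<Rightarrow> key \<Rightarrow> expr) \<Rightarrow> com" where
  "layer_com E = Seq (nest (length keys) 10 3 (gate_com E)) (Add 5 5 4)"

definition layer_cost :: "(nat \<Rightarrow> key \<Rightarrow> expr) \<Rightarrow> nat \<Rightarrow> nat" where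
  "layer_cost E n = nest_cost (length keys) (base n) (gate_cost E (base n)) + 1"

definition layer_out :: "nat \<Rightarrow> nat \<Rightarrow> layer \<Rightarrow> nat list" where
  "layer_out n b L = concat (map (\<lambda>ds. encode_node (Thr2 (map (\<lambda>j. b
     + enc (base n) (child_digits n L j ds)) [0..<k + 1]))) (enum (length keys) (base n)))"

lemma tr_layer:
  assumes env: "env n f"
    and E: "\<And>j q. q \<in> set keys \<Longrightarrow> below scratch (E j q)"
      "\<And>j q ds. q \<in> set keys \<Longrightarrow> length ds = length keys \<Longrightarrow>
        eval (put f 10 ds) (E j q) = child (nvars n) L j (state ds) q"
  shows "tr 10 f (layer_com E) 10 (f(5 := f 5 + width n)) (layer_out n (f 5) L) (layer_cost E n)"
proof -
  let ?out = "\<lambda>ds. encode_node (Thr2 (map (\<lambda>j. f 5 + enc (base n) (child_digits n L j ds)) [0..<k + 1]))"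
  have gate: "tr scratch (put f 10 ds) (gate_com E) scratch (put f 10 ds) (?out ds) (gate_cost E (base n))"
    if ds: "length ds = length keys" for ds
  proof -
    let ?f = "put f 10 ds" and ?es = "\<lambda>j. map (\<lambda>q. clipE 3 (E j q)) keys"
    have f: "?f 3 = base n" "?f 5 = f 5" using env by (auto simp: put_def env_def)
    have "tr scratch ?f (emit_code 3 5 (?es j) scratch) scratch ?f
        [f 5 + enc (base n) (child_digits n L j ds)] (horner_cost (?es j) (base n) + 2)" for j
    proof -
      have "map (eval ?f) (?es j) = child_digits n L j ds"
        using E(2) ds by (simp add: child_digits_def eval_clipE f)
      moreover have "below scratch e" if "e \<in> set (?es j)" for e
        using that E(1) by (auto simp: clipE_def)
      ultimately show ?thesis
        using tr_emit_code[of 3 scratch 5 "?es j" ?f] f by simp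
    qed
    then have "tr scratch ?f (seqs scratch (map (\<lambda>j. emit_code 3 5 (?es j) scratch) [0..<k + 1])) scratch ?f
        (concat (map (\<lambda>i. [f 5 + enc (base n) (child_digits n L ([0..<k + 1] ! i) ds)]) [0..<length [0..<k + 1]]))
        (1 + (\<Sum>j\<leftarrow>[0..<k + 1]. horner_cost (?es j) (base n) + 2))"
      by (intro tr_seqs[where f = "\<lambda>_. ?f"]) simp
    from tr_Seq[OF tr_emit_num[of scratch ?f 1] tr_Seq[OF tr_emit_num[of scratch ?f "k + 1"] this]] show ?thesis
      unfolding gate_com_def
    proof (rule tr_weaken)
      have "map (\<lambda>i. f 5 + enc (base n) (child_digits n L ([0..<k + 1] ! i) ds)) [0..<length [0..<k + 1]]
          = map (\<lambda>j. f 5 + enc (base n) (child_digits n L j ds)) [0..<k + 1]"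
        by (rule map_cong) (auto simp del: upt_Suc)
      then show "?out ds = [1] @ [k + 1] @
          concat (map (\<lambda>i. [f 5 + enc (base n) (child_digits n L ([0..<k + 1] ! i) ds)]) [0..<length [0..<k + 1]])"
        by (simp del: upt_Suc)
    qed (auto simp: gate_cost_def simp del: upt_Suc)
  qed
  have "tr 10 f (nest (length keys) 10 3 (gate_com E)) 10 f (layer_out n (f 5) L)
      (nest_cost (length keys) (base n) (gate_cost E (base n)))"
    unfolding layer_out_def
    by (rule tr_nest) (use gate env in \<open>simp_all add: env_def\<close>)
  moreover have "tr 10 f (Add 5 5 4) 10 (f(5 := f 5 + width n)) [] 1"
    by (rule tr_Add) (use env in \<open>auto simp: env_def\<close>)
  ultimately have "tr 10 f (layer_com E) 10 (f(5 := f 5 + width n)) (layer_out n (f 5) L @ [])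
      (layer_cost E n)"
    unfolding layer_com_def layer_cost_def by (rule tr_Seq)
  then show ?thesis by simp
qed

text \<open>\<open>b\<close> is the index of the first node in the layer after the first one listed,
  since that is where its gates point.\<close>

definition outs :: "nat \<Rightarrow> nat \<Rightarrow> layer list \<Rightarrow> nat list" where
  "outs n b Ls = concat (map (\<lambda>i. layer_out n (b + i * width n) (Ls ! i)) [0..<length Ls])"

lemma outs_append: "outs n b (Ls @ Ls') = outs n b Ls @ outs n (b + length Ls * width n) Ls'"
proof -
  let ?a = "length Ls" and ?b = "length Ls'"
  let ?F = "\<lambda>i. layer_out n (b + i * width n) ((Ls @ Ls') ! i)"
  have "[?a..<?a + ?b] = map (\<lambda>i. i + ?a) [0..<?b]"
    by (simp only: map_add_upt add.commute)
  then have "[0..<?a + ?b] = [0..<?a] @ map (\<lambda>i. i + ?a) [0..<?b]"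
    using upt_add_eq_append[of 0 ?a ?b] by simp
  then have "outs n b (Ls @ Ls')
      = concat (map ?F [0..<?a]) @ concat (map (\<lambda>i. ?F (i + ?a)) [0..<?b])"
    by (simp add: outs_def comp_def)
  moreover have "map ?F [0..<?a] = map (\<lambda>i. layer_out n (b + i * width n) (Ls ! i)) [0..<?a]"
    by (rule map_cong) (auto simp: nth_append)
  moreover have "map (\<lambda>i. ?F (i + ?a)) [0..<?b]
      = map (\<lambda>i. layer_out n (b + ?a * width n + i * width n) (Ls' ! i)) [0..<?b]"
    by (rule map_cong) (auto simp: nth_append algebra_simps)
  ultimately show ?thesis by (simp only: outs_def)
qed

lemma outs_blocks:
  assumes "\<And>q. q < L \<Longrightarrow> length (F q) = c"
  shows "outs n b (concat (map F [0..<L])) = concat (map (\<lambda>q. outs n (b + q * (c * width n)) (F q)) [0..<L])"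
  using assms
proof (induction L)
  case (Suc L)
  then have "length (concat (map F [0..<L])) = L * c"
    by (intro length_concat_blocks) simp
  then show ?case using Suc by (simp add: outs_append mult.assoc)
qed (simp add: outs_def)

section \<open>Writing the rounds\<close>

definition pairs :: "(nat list \<times> nat) list" where
  "pairs = List.product tuples [0..<k]"

lemma refine_eq: "refine w = map (\<lambda>(t, i). Split w t i) pairs"
  by (simp add: refine_def pairs_def product_concat_map map_concat comp_def)

lemma length_pairs: "length pairs = k ^ k * k"
  using length_refine[of 0] by (simp add: refine_eq)

text \<open>Unrolled rather than a loop: the number of pairs depends on \<open>k\<close> only, and
  \<open>split_expr\<close> needs each pair as a constant.\<close>

definition refine_com :: com where
  "refine_com = seqs 10 (map (\<lambda>p. layer_com (split_expr (fst p) (snd p))) pairs)"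

definition refine_cost :: "nat \<Rightarrow> nat" where
  "refine_cost n = 1 + (\<Sum>p\<leftarrow>pairs. layer_cost (split_expr (fst p) (snd p)) n)"

lemma tr_refine:
  assumes env: "env n f"
  shows "tr 10 f refine_com 10 (f(5 := f 5 + k ^ k * k * width n)) (outs n (f 5) (refine (f 9))) (refine_cost n)"
proof -
  let ?g = "\<lambda>i. f(5 := f 5 + i * width n)"
  have "tr 10 (?g i) (layer_com (split_expr (fst (pairs ! i)) (snd (pairs ! i)))) 10 (?g (Suc i))
      (layer_out n (f 5 + i * width n) (refine (f 9) ! i))
      (layer_cost (split_expr (fst (pairs ! i)) (snd (pairs ! i))) n)" if i: "i < length pairs" for i
  proof -
    let ?t = "fst (pairs ! i)" and ?i = "snd (pairs ! i)"
    have "(?t, ?i) \<in> set pairs" using i by simp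
    then have "?i < k" by (auto simp: pairs_def)
    moreover have "refine (f 9) ! i = Split (f 9) ?t ?i"
      using i by (simp add: refine_eq split_beta)
    ultimately have "tr 10 (?g i) (layer_com (split_expr ?t ?i)) 10 ((?g i)(5 := (?g i) 5 + width n))
      (layer_out n ((?g i) 5) (refine (f 9) ! i)) (layer_cost (split_expr ?t ?i) n)"
      using split_expr(1)[of _ ?i ?t] split_expr(2)[of _ ?i _ "?g i" ?t _ "nvars n"] env
      by (intro tr_layer) (auto simp: env_def)
    then show ?thesis by (rule tr_weaken) auto
  qed
  then have "tr 10 (?g 0) refine_com 10 (?g (length pairs))
      (concat (map (\<lambda>i. layer_out n (f 5 + i * width n) (refine (f 9) ! i)) [0..<length pairs])) (refine_cost n)"
    unfolding refine_com_def refine_cost_def by (rule tr_seqs)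
  moreover have "length (refine (f 9)) = length pairs" by (simp add: refine_eq)
  ultimately show ?thesis by (simp add: outs_def length_pairs)
qed

text \<open>Loops count up, whereas weights and segment lengths run down.\<close>

lemma rev_upt_0: "rev [0..<H] = map (\<lambda>q. H - 1 - q) [0..<H]"
  by (rule nth_equalityI) (auto simp: rev_nth)

definition power_com :: "nat \<Rightarrow> com" where
  "power_com m = power_of_two (Minus (Minus (Reg 2) (Num 1)) (Reg m)) (Suc m)"

lemma tr_power_com:
  assumes "2 < m"
  shows "tr (Suc m) (f(m := q)) (power_com m) (Suc (Suc m)) (f(m := q, Suc m := 2 ^ (f 2 - 1 - q)))
    [] (11 + f 2 * 5)"
  unfolding power_com_def
  by (rule tr_weaken[OF tr_power_of_two[of "Suc m" _ "f(m := q)"]]) (use assms in auto)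

definition refines_com :: com where
  "refines_com = loop 8 2 (Seq (power_com 8) refine_com)"

definition refines_cost :: "nat \<Rightarrow> nat" where
  "refines_cost n = 3 + levels n * (11 + levels n * 5 + refine_cost n + 4)"

lemma tr_refines:
  assumes env: "env n f"
  shows "tr 8 f refines_com 8 (f(5 := f 5 + levels n * (k ^ k * k) * width n))
    (outs n (f 5) (concat (map (\<lambda>g. refine (2 ^ g)) (rev [0..<levels n])))) (refines_cost n)"
proof -
  let ?H = "levels n" and ?K = "k ^ k * k * width n"
  let ?g = "\<lambda>q. f(5 := f 5 + q * ?K)"
  have H: "f 2 = ?H" using env by (simp add: env_def)
  have step: "tr (Suc 8) ((?g q)(8 := q)) (Seq (power_com 8) refine_com) (Suc 8) ((?g (Suc q))(8 := q))
      (outs n (f 5 + q * ?K) (refine (2 ^ (?H - 1 - q)))) (11 + ?H * 5 + refine_cost n)" for q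
  proof -
    let ?h = "(?g q)(8 := q, 9 := 2 ^ (?H - 1 - q))"
    have "tr 9 ((?g q)(8 := q)) (power_com 8) 10 ?h [] (11 + ?H * 5)"
      by (rule tr_weaken[OF tr_power_com[of 8 "?g q" q]]) (use H in auto)
    moreover have "tr 10 ?h refine_com 10 (?h(5 := ?h 5 + ?K)) (outs n (?h 5) (refine (?h 9))) (refine_cost n)"
      by (rule tr_refine) (use env in \<open>simp add: env_def\<close>)
    ultimately have "tr 9 ((?g q)(8 := q)) (Seq (power_com 8) refine_com) 10 (?h(5 := ?h 5 + ?K))
        ([] @ outs n (?h 5) (refine (?h 9))) (11 + ?H * 5 + refine_cost n)"
      by (rule tr_Seq)
    then show ?thesis by (rule tr_weaken) auto
  qed
  have "tr 8 (?g 0) refines_com 8 (?g ?H)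
      (concat (map (\<lambda>q. outs n (f 5 + q * ?K) (refine (2 ^ (?H - 1 - q)))) [0..<?H])) (refines_cost n)"
    unfolding refines_com_def refines_cost_def
  proof (rule tr_loop)
    show "?g q 2 = ?H" for q using H by simp
  next
    fix q
    show "tr (Suc 8) ((?g q)(8 := q)) (Seq (power_com 8) refine_com) (Suc 8) ((?g (Suc q))(8 := q))
      (outs n (f 5 + q * ?K) (refine (2 ^ (?H - 1 - q)))) (11 + ?H * 5 + refine_cost n)"
      by (rule step)
  qed simp
  moreover have "outs n (f 5) (concat (map (\<lambda>g. refine (2 ^ g)) (rev [0..<?H])))
      = concat (map (\<lambda>q. outs n (f 5 + q * ?K) (refine (2 ^ (?H - 1 - q)))) [0..<?H])"
    unfolding rev_upt_0 map_map comp_def by (rule outs_blocks) (rule length_refine)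
  ultimately show ?thesis by (simp add: mult.assoc)
qed

text \<open>\<open>tr_layer\<close> presupposes known contents of all registers below 10. Registers
  8 and 9 are free again after the refinement loop, hence the two constants.\<close>

definition phase_com :: com where
  "phase_com = Seq (power_com 6) (Seq refines_com
     (Seq (Const 8 0) (Seq (Const 9 0) (layer_com (\<lambda>_. commit_expr)))))"

definition phase_cost :: "nat \<Rightarrow> nat" where
  "phase_cost n = 11 + levels n * 5 + (refines_cost n + (1 + (1 + layer_cost (\<lambda>_. commit_expr) n)))"

definition phases_com :: com where
  "phases_com = loop 6 2 phase_com"

lemma tr_phase:
  assumes env: "env n f" and s: "q < levels n"
  shows "tr 7 (f(6 := q)) phase_com 7 (f(5 := f 5 + (levels n * (k ^ k * k) + 1) * width n, 6 := q))
    (outs n (f 5) (phase (levels n) (levels n - 1 - q))) (phase_cost n)"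
proof -
  let ?H = "levels n" and ?s = "2 ^ (levels n - 1 - q) :: nat"
  let ?Ls = "concat (map (\<lambda>g. refine (2 ^ g)) (rev [0..<?H]))"
  have H: "f 2 = ?H" using env by (simp add: env_def)
  let ?f1 = "f(6 := q, 7 := ?s)"
  let ?f2 = "?f1(5 := ?f1 5 + ?H * (k ^ k * k) * width n)"
  let ?f3 = "?f2(8 := 0, 9 := 0)"
  have "tr 7 (f(6 := q)) (power_com 6) 8 ?f1 [] (11 + ?H * 5)"
    by (rule tr_weaken[OF tr_power_com[of 6 f q]]) (use H in auto)
  moreover have "tr 8 ?f1 refines_com 8 ?f2 (outs n (?f1 5) ?Ls) (refines_cost n)"
    by (rule tr_refines) (use env in \<open>simp add: env_def\<close>)
  moreover have "tr 8 ?f2 (Const 8 0) 9 (?f2(8 := 0)) [] 1" by (rule tr_Const) auto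
  moreover have "tr 9 (?f2(8 := 0)) (Const 9 0) 10 ?f3 [] 1" by (rule tr_Const) auto
  moreover have "tr 10 ?f3 (layer_com (\<lambda>_. commit_expr)) 10 (?f3(5 := ?f3 5 + width n))
      (layer_out n (?f3 5) (Commit ?s)) (layer_cost (\<lambda>_. commit_expr) n)"
  proof (rule tr_layer)
    fix j q' and ds :: "nat list" assume "q' \<in> set keys" "length ds = length keys"
    then have "eval (put ?f3 10 ds) (commit_expr q') = child (nvars n) (Commit (?f3 7)) j (state ds) q'"
      by (rule commit_eval) (use env in \<open>simp add: env_def\<close>)
    then show "eval (put ?f3 10 ds) (commit_expr q') = child (nvars n) (Commit ?s) j (state ds) q'"
      by simp
  qed (use env commit_below in \<open>auto simp: env_def\<close>)
  ultimately have "tr 7 (f(6 := q)) phase_com 10 (?f3(5 := ?f3 5 + width n))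
      ([] @ outs n (?f1 5) ?Ls @ [] @ [] @ layer_out n (?f3 5) (Commit ?s)) (phase_cost n)"
    unfolding phase_com_def phase_cost_def by (intro tr_Seq)
  then show ?thesis
  proof (rule tr_weaken)
    have "length ?Ls = ?H * (k ^ k * k)" using length_phase[of ?H 0] by (simp add: phase_def)
    then show "outs n (f 5) (phase ?H (?H - 1 - q))
        = [] @ outs n (?f1 5) ?Ls @ [] @ [] @ layer_out n (?f3 5) (Commit ?s)"
      by (simp add: phase_def outs_append) (simp add: outs_def)
  qed (auto simp: algebra_simps)
qed

lemma tr_phases:
  assumes env: "env n f"
  shows "tr 6 f phases_com 6 (f(5 := f 5 + length (layers n) * width n)) (outs n (f 5) (layers n))
    (3 + levels n * (phase_cost n + 4))"
proof -
  let ?H = "levels n" and ?K = "(levels n * (k ^ k * k) + 1) * width n"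
  let ?g = "\<lambda>q. f(5 := f 5 + q * ?K)"
  have loop: "tr 6 (?g 0) phases_com 6 (?g ?H)
      (concat (map (\<lambda>q. outs n (f 5 + q * ?K) (phase ?H (?H - 1 - q))) [0..<?H]))
      (3 + ?H * (phase_cost n + 4))"
    unfolding phases_com_def
  proof (rule tr_loop)
    show "?g q 2 = ?H" for q using env by (simp add: env_def)
  next
    fix q assume q: "q < ?H"
    have "env n (?g q)" using env by (simp add: env_def)
    from tr_phase[OF this q]
    show "tr (Suc 6) ((?g q)(6 := q)) phase_com (Suc 6) ((?g (Suc q))(6 := q))
        (outs n (f 5 + q * ?K) (phase ?H (?H - 1 - q))) (phase_cost n)"
      by (rule tr_weaken) auto
  qed simp
  have "outs n (f 5) (layers n)
      = concat (map (\<lambda>q. outs n (f 5 + q * ?K) (phase ?H (?H - 1 - q))) [0..<?H])"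
    unfolding layers_def rev_upt_0 map_map comp_def by (rule outs_blocks) (rule length_phase)
  then show ?thesis
    by (intro tr_weaken[OF loop]) (auto simp: length_layers algebra_simps)
qed

section \<open>Writing the leaves\<close>

definition leaf_expr :: expr where
  "leaf_expr = clipE 1 (digit (Start [0..<k]))"

definition leaf_com :: com where
  "leaf_com = Seq (emit_num 0 scratch) (Seq (compile leaf_expr scratch) (Emit scratch))"

definition leaf_out :: "nat \<Rightarrow> nat list" where
  "leaf_out n = concat (map (\<lambda>ds. encode_node (Var (leaf_var n ds))) (enum (length keys) (base n)))"

definition leaves_com :: com where
  "leaves_com = Seq (Const 6 0) (Seq (Const 7 0) (Seq (Const 8 0) (Seq (Const 9 0)
     (nest (length keys) 10 3 leaf_com))))"

definition leaves_cost :: "nat \<Rightarrow> nat" where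
  "leaves_cost n = 4 + nest_cost (length keys) (base n) (3 + cost leaf_expr)"

lemma tr_leaves:
  assumes env: "env n f"
  shows "tr 6 f leaves_com 6 f (leaf_out n) (leaves_cost n)"
proof -
  let ?g = "f(6 := 0, 7 := 0, 8 := 0, 9 := 0)"
  have key: "Start [0..<k] \<in> set keys" by (auto simp: keys tuples)
  have leaf: "tr scratch (put ?g 10 ds) leaf_com scratch (put ?g 10 ds) (encode_node (Var (leaf_var n ds)))
      (3 + cost leaf_expr)" if "length ds = length keys" for ds
  proof -
    let ?f = "put ?g 10 ds"
    have "?f 1 = nvars n" using env by (simp add: put_def env_def)
    then have v: "eval ?f leaf_expr = leaf_var n ds"
      unfolding leaf_expr_def leaf_var_def using eval_digit[OF key that] by (simp add: eval_clipE)
    have "below scratch leaf_expr" using below_digit[OF key] by (simp add: leaf_expr_def clipE_def)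
    then have "tr scratch ?f (compile leaf_expr scratch) (Suc scratch) (?f(scratch := leaf_var n ds)) [] (cost leaf_expr)"
      using tr_compile v by metis
    moreover have "tr (Suc scratch) (?f(scratch := leaf_var n ds)) (Emit scratch) scratch ?f [leaf_var n ds] 1"
      by (rule tr_weaken[OF tr_Emit[of scratch "Suc scratch" "?f(scratch := leaf_var n ds)"]]) auto
    ultimately have "tr scratch ?f leaf_com scratch ?f ([0] @ [] @ [leaf_var n ds]) (2 + (cost leaf_expr + 1))"
      unfolding leaf_com_def by (intro tr_Seq[OF tr_emit_num] tr_Seq)
    then show ?thesis by (rule tr_weaken) auto
  qed
  have "tr 6 f (Const 6 0) 7 (f(6 := 0)) [] 1" by (rule tr_Const) auto
  moreover have "tr 7 (f(6 := 0)) (Const 7 0) 8 (f(6 := 0, 7 := 0)) [] 1" by (rule tr_Const) auto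
  moreover have "tr 8 (f(6 := 0, 7 := 0)) (Const 8 0) 9 (f(6 := 0, 7 := 0, 8 := 0)) [] 1"
    by (rule tr_Const) auto
  moreover have "tr 9 (f(6 := 0, 7 := 0, 8 := 0)) (Const 9 0) 10 ?g [] 1" by (rule tr_Const) auto
  moreover have "tr 10 ?g (nest (length keys) 10 3 leaf_com) 10 ?g (leaf_out n)
      (nest_cost (length keys) (base n) (3 + cost leaf_expr))"
    unfolding leaf_out_def by (rule tr_nest) (use leaf env in \<open>simp_all add: env_def\<close>)
  ultimately have "tr 6 f leaves_com 10 ?g ([] @ [] @ [] @ [] @ leaf_out n)
      (1 + (1 + (1 + (1 + nest_cost (length keys) (base n) (3 + cost leaf_expr)))))"
    unfolding leaves_com_def by (intro tr_Seq)
  then show ?thesis by (rule tr_weaken) (auto simp: leaves_cost_def)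
qed

section \<open>Computing the parameters\<close>

definition nvars_expr :: expr where
  "nvars_expr = Plus (Num 1) (sumE (replicate k (Reg 0)))"

text \<open>A search for the first power of two above \<open>nvars n\<close>. It runs
  \<open>nvars n\<close> passes, enough by \<open>levels_le\<close>; once the power is found, the
  guard \<open>c\<close> freezes both registers. The guard reads registers 1 and 3, so updating 2
  first does not disturb it.\<close>

definition levels_com :: com where
  "levels_com = (let c = Minus (Plus (Reg 1) (Num 1)) (Reg 3) in loop 4 1
     (Seq (assign 2 (Cond c (Plus (Reg 2) (Num 1)) (Reg 2)) 5)
        (assign 3 (Cond c (Plus (Reg 3) (Reg 3)) (Reg 3)) 5)))"

definition width_com :: com where
  "width_com = seqs 5 (map (\<lambda>_. Seq (multiply 4 3 5) (assign 4 (Reg 5) 6)) [0..<length keys])"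

lemma levels_le: "levels n \<le> nvars n"
proof (rule ccontr)
  assume "\<not> ?thesis"
  then have "2 ^ nvars n \<le> nvars n" using less_levels_iff[of "nvars n" n] by simp
  then show False using less_exp[of "nvars n"] by simp
qed

lemma tr_levels:
  assumes "f 1 = nvars n"
  shows "tr 4 (f(2 := 0, 3 := 1)) levels_com 4 (f(2 := levels n, 3 := 2 ^ levels n)) [] (3 + nvars n * 37)"
proof -
  let ?h = "\<lambda>q. min q (levels n)"
  let ?g = "\<lambda>q. f(2 := ?h q, 3 := 2 ^ ?h q)"
  let ?c = "Minus (Plus (Reg 1) (Num 1)) (Reg 3)"
  let ?e = "Cond ?c (Plus (Reg 2) (Num 1)) (Reg 2)" and ?e' = "Cond ?c (Plus (Reg 3) (Reg 3)) (Reg 3)"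
  have h: "nvars n + 1 - 2 ^ ?h q \<noteq> 0 \<longleftrightarrow> q < levels n" for q
  proof -
    have "nvars n + 1 - 2 ^ ?h q \<noteq> 0 \<longleftrightarrow> 2 ^ ?h q \<le> nvars n" by auto
    also have "\<dots> \<longleftrightarrow> q < levels n" unfolding less_levels_iff[symmetric] by auto
    finally show ?thesis .
  qed
  have "tr 4 (?g 0) levels_com 4 (?g (nvars n)) (concat (map (\<lambda>_. []) [0..<nvars n])) (3 + nvars n * (33 + 4))"
    unfolding levels_com_def Let_def
  proof (rule tr_loop)
    fix q
    let ?f1 = "(?g q)(4 := q)" and ?f2 = "(?g q)(4 := q, 2 := ?h (Suc q))"
    have "eval ?f1 ?e = ?h (Suc q)" using h[of q] assms by auto
    then have 1: "tr 5 ?f1 (assign 2 ?e 5) 5 ?f2 [] 16"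
      using tr_assign[of 5 ?e 2 ?f1] by simp
    have "eval ?f2 ?e' = 2 ^ ?h (Suc q)"
      using h[of q] assms by (auto simp: min_def not_less_eq_eq)
    then have "tr 5 ?f2 (assign 3 ?e' 5) 5 (?f2(3 := 2 ^ ?h (Suc q))) [] 17"
      using tr_assign[of 5 ?e' 3 ?f2] by simp
    from tr_Seq[OF 1 this]
    show "tr (Suc 4) ?f1 (Seq (assign 2 ?e 5) (assign 3 ?e' 5)) (Suc 4) ((?g (Suc q))(4 := q)) [] 33"
      by (rule tr_weaken) auto
  qed (use assms in simp_all)
  then show ?thesis by (rule tr_weaken) (use levels_le[of n] in \<open>auto simp: min_def\<close>)
qed

lemma tr_width:
  assumes "f 3 = base n" "f 4 = 1"
  shows "tr 5 f width_com 5 (f(4 := width n)) [] (1 + length keys * (8 + base n * 5))"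
proof -
  let ?g = "\<lambda>i. f(4 := base n ^ i)"
  have "tr 5 (?g i) (Seq (multiply 4 3 5) (assign 4 (Reg 5) 6)) 5 (?g (Suc i)) [] (8 + base n * 5)" for i
  proof -
    have "tr 5 (?g i) (multiply 4 3 5) 6 ((?g i)(5 := base n ^ i * base n)) [] (4 + base n * 5)"
      by (rule tr_weaken[OF tr_multiply]) (use assms in auto)
    moreover have "tr 6 ((?g i)(5 := base n ^ i * base n)) (assign 4 (Reg 5) 6) 6
        ((?g i)(5 := base n ^ i * base n, 4 := base n ^ i * base n)) [] 4"
      by (rule tr_weaken[OF tr_assign]) auto
    ultimately have "tr 5 (?g i) (Seq (multiply 4 3 5) (assign 4 (Reg 5) 6)) 6
        ((?g i)(5 := base n ^ i * base n, 4 := base n ^ i * base n)) ([] @ []) (4 + base n * 5 + 4)"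
      by (rule tr_Seq)
    then show ?thesis by (rule tr_weaken) auto
  qed
  then have "tr 5 (?g 0) width_com 5 (?g (length [0..<length keys]))
      (concat (map (\<lambda>_. []) [0..<length [0..<length keys]]))
      (1 + (\<Sum>_\<leftarrow>[0..<length keys]. 8 + base n * 5))"
    unfolding width_com_def by (intro tr_seqs)
  then show ?thesis
    by (rule tr_weaken) (use assms in \<open>auto simp: width_def sum_list_triv\<close>)
qed

fun init_expr :: "key \<Rightarrow> expr" where
  "init_expr (Start t) = Num 0"
| "init_expr (Bound t i) = Reg 0"
| "init_expr (Parent i) = Num i"
| "init_expr (Guess t i) = Num 0"

definition setup_com :: com where
  "setup_com = Seq (compile nvars_expr 1) (Seq (Const 2 0) (Seq (Const 3 1) (Seq levels_com
     (Seq (assign 3 (Plus (Reg 3) (Num k)) 4) (Seq (Const 4 1) (Seq width_com (Const 5 0)))))))"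

definition setup_cost :: "nat \<Rightarrow> nat" where
  "setup_cost n = cost nvars_expr + (1 + (1 + (3 + nvars n * 37 + (6 + (1
     + (1 + length keys * (8 + base n * 5) + 1))))))"

lemma tr_setup:
  assumes f: "f 0 = n"
  shows "\<exists>g. env n g \<and> g 5 = 0 \<and> tr 1 f setup_com 6 g [] (setup_cost n)"
proof (intro exI conjI)
  let ?f1 = "f(1 := nvars n)"
  let ?f2 = "?f1(2 := levels n, 3 := 2 ^ levels n)"
  let ?f3 = "?f2(3 := base n)"
  let ?g = "?f3(4 := width n, 5 := 0)"
  show "env n ?g" "?g 5 = 0" using f by (simp_all add: env_def)
  have "below 1 nvars_expr" by (simp add: nvars_expr_def)
  moreover have "eval f nvars_expr = nvars n"
    using f by (simp add: nvars_expr_def nvars_def sum_list_replicate)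
  ultimately have "tr 1 f (compile nvars_expr 1) 2 ?f1 [] (cost nvars_expr)"
    using tr_compile[of 1 nvars_expr f] by (simp add: numeral_2_eq_2)
  moreover have "tr 2 ?f1 (Const 2 0) 3 (?f1(2 := 0)) [] 1" by (rule tr_Const) auto
  moreover have "tr 3 (?f1(2 := 0)) (Const 3 1) 4 (?f1(2 := 0, 3 := 1)) [] 1" by (rule tr_Const) auto
  moreover have "tr 4 (?f1(2 := 0, 3 := 1)) levels_com 4 ?f2 [] (3 + nvars n * 37)"
    by (rule tr_levels) simp
  moreover have "tr 4 ?f2 (assign 3 (Plus (Reg 3) (Num k)) 4) 4 ?f3 [] 6"
    by (rule tr_weaken[OF tr_assign]) (auto simp: base_def)
  moreover have "tr 4 ?f3 (Const 4 1) 5 (?f3(4 := 1)) [] 1" by (rule tr_Const) auto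
  moreover have "tr 5 (?f3(4 := 1)) width_com 5 (?f3(4 := width n)) [] (1 + length keys * (8 + base n * 5))"
    by (rule tr_weaken[OF tr_width[of "?f3(4 := 1)" n]]) auto
  moreover have "tr 5 (?f3(4 := width n)) (Const 5 0) 6 ?g [] 1" by (rule tr_Const) auto
  ultimately have "tr 1 f setup_com 6 ?g ([] @ [] @ [] @ [] @ [] @ [] @ [] @ []) (setup_cost n)"
    unfolding setup_com_def setup_cost_def by (intro tr_Seq)
  then show "tr 1 f setup_com 6 ?g [] (setup_cost n)" by simp
qed

text \<open>Register 5 is 0 while the output node in layer 0 is emitted, and is then set to
  \<open>width n\<close>, the index of the first node of layer 1.\<close>

definition generator :: com where
  "generator = Seq setup_com (Seq (emit_code 3 5 (map init_expr keys) 6)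
     (Seq (assign 5 (Reg 4) 6) (Seq phases_com leaves_com)))"

definition generator_cost :: "nat \<Rightarrow> nat" where
  "generator_cost n = setup_cost n + (horner_cost (map init_expr keys) (base n) + 2
     + (4 + (3 + levels n * (phase_cost n + 4) + leaves_cost n)))"

lemma encode_circ:
  "encode_circuit (circ n) = enc (base n) (init_digits n) # outs n (width n) (layers n) @ leaf_out n"
proof -
  let ?E = "enum (length keys) (base n)" and ?T = "length (layers n)"
  have "concat (map encode_node (map (node n l) ?E)) = layer_out n (width n + l * width n) (layers n ! l)"
    if "l < ?T" for l
    using that by (simp add: layer_out_def node_def comp_def)
  then have "concat (map (\<lambda>l. concat (map encode_node (map (node n l) ?E))) [0..<?T])
      = outs n (width n) (layers n)"
    unfolding outs_def by (intro arg_cong[of _ _ concat] map_cong) auto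
  moreover have "concat (map encode_node (map (node n ?T) ?E)) = leaf_out n"
    by (simp add: leaf_out_def node_def comp_def)
  ultimately show ?thesis
    by (simp add: encode_circuit_def circ_def concat_map_concat comp_def)
qed

lemma tr_generator:
  assumes f: "f 0 = n"
  shows "\<exists>g. tr 1 f generator 6 g (encode_circuit (circ n)) (generator_cost n)"
proof -
  from tr_setup[of f n, OF f] obtain g where g: "env n g" "g 5 = 0"
    and 1: "tr 1 f setup_com 6 g [] (setup_cost n)" by blast
  have "eval g (init_expr q) = init_digit n q" "below 6 (init_expr q)" for q
    using g by (cases q; simp add: env_def)+
  then have 2: "tr 6 g (emit_code 3 5 (map init_expr keys) 6) 6 g [enc (base n) (init_digits n)]
      (horner_cost (map init_expr keys) (base n) + 2)"
    using tr_emit_code[of 3 6 5 "map init_expr keys" g] g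
    by (auto simp: env_def init_digits_def comp_def)
  let ?g = "g(5 := width n)"
  have 3: "tr 6 g (assign 5 (Reg 4) 6) 6 ?g [] 4"
    by (rule tr_weaken[OF tr_assign]) (use g in \<open>auto simp: env_def\<close>)
  let ?h = "?g(5 := ?g 5 + length (layers n) * width n)"
  have 4: "tr 6 ?g phases_com 6 ?h (outs n (?g 5) (layers n)) (3 + levels n * (phase_cost n + 4))"
    by (rule tr_phases) (use g in \<open>simp add: env_def\<close>)
  have 5: "tr 6 ?h leaves_com 6 ?h (leaf_out n) (leaves_cost n)"
    by (rule tr_leaves) (use g in \<open>simp add: env_def\<close>)
  from tr_Seq[OF 1 tr_Seq[OF 2 tr_Seq[OF 3 tr_Seq[OF 4 5]]]]
  have "tr 1 f generator 6 ?h (encode_circuit (circ n)) (generator_cost n)"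
    unfolding generator_def generator_cost_def encode_circ by simp
  then show ?thesis by blast
qed

end

section \<open>Polynomial bounds\<close>

definition poly_bounded :: "(nat \<Rightarrow> nat) \<Rightarrow> bool" where
  "poly_bounded f \<longleftrightarrow> (\<exists>p :: nat poly. \<forall>n. f n \<le> poly p n)"

lemma poly_bounded_const: "poly_bounded (\<lambda>_. c)"
  unfolding poly_bounded_def by (rule exI[of _ "[:c:]"]) simp

lemma poly_bounded_id: "poly_bounded (\<lambda>n. n)"
  unfolding poly_bounded_def by (rule exI[of _ "[:0, 1:]"]) simp

lemma poly_bounded_add:
  assumes "poly_bounded f" "poly_bounded g"
  shows "poly_bounded (\<lambda>n. f n + g n)"
proof -
  from assms obtain p q :: "nat poly" where "\<And>n. f n \<le> poly p n" "\<And>n. g n \<le> poly q n"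
    by (auto simp: poly_bounded_def)
  then show ?thesis
    unfolding poly_bounded_def by (intro exI[of _ "p + q"]) (simp add: add_mono)
qed

lemma poly_bounded_mult:
  assumes "poly_bounded f" "poly_bounded g"
  shows "poly_bounded (\<lambda>n. f n * g n)"
proof -
  from assms obtain p q :: "nat poly" where "\<And>n. f n \<le> poly p n" "\<And>n. g n \<le> poly q n"
    by (auto simp: poly_bounded_def)
  then show ?thesis
    unfolding poly_bounded_def by (intro exI[of _ "p * q"]) (simp add: mult_mono)
qed

lemma poly_bounded_mono: "poly_bounded g \<Longrightarrow> (\<And>n. f n \<le> g n) \<Longrightarrow> poly_bounded f"
  unfolding poly_bounded_def by (meson order_trans)

lemma poly_bounded_power: "poly_bounded f \<Longrightarrow> poly_bounded (\<lambda>n. f n ^ d)"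
  by (induction d) (simp_all add: poly_bounded_const poly_bounded_mult)

lemma poly_bounded_sum_list:
  "(\<And>x. x \<in> set xs \<Longrightarrow> poly_bounded (f x)) \<Longrightarrow> poly_bounded (\<lambda>n. \<Sum>x\<leftarrow>xs. f x n)"
  by (induction xs) (simp_all add: poly_bounded_const poly_bounded_add)

text \<open>The degree grows with \<open>D\<close>, which does not depend on
  \<open>n\<close>.\<close>

lemma poly_bounded_nest_cost:
  "poly_bounded f \<Longrightarrow> poly_bounded g \<Longrightarrow> poly_bounded (\<lambda>n. nest_cost D (f n) (g n))"
  by (induction D) (simp_all add: poly_bounded_const poly_bounded_add poly_bounded_mult
      del: add_Suc add_Suc_right)

lemmas poly_bounded_intros = poly_bounded_const poly_bounded_id poly_bounded_add
  poly_bounded_mult poly_bounded_power poly_bounded_sum_list poly_bounded_nest_cost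

context arity begin

section \<open>Bounds on time, size and depth\<close>

lemma poly_bounded_nvars: "poly_bounded nvars"
  unfolding nvars_def by (intro poly_bounded_intros)

lemma poly_bounded_levels: "poly_bounded levels"
  using poly_bounded_nvars levels_le by (rule poly_bounded_mono)

text \<open>\<open>levels n\<close> is the least exponent whose power of two exceeds
  \<open>nvars n\<close>. The factor 2 makes \<open>base n\<close> linear in \<open>n\<close> and
  \<open>width n\<close> a fixed power of a linear term.\<close>

lemma power_levels_le: "2 ^ levels n \<le> 2 * nvars n"
proof -
  have "0 < levels n" unfolding less_levels_iff by (simp add: nvars_def)
  then have "2 ^ (levels n - 1) \<le> nvars n" unfolding less_levels_iff[symmetric] by simp
  then have "2 * 2 ^ (levels n - 1) \<le> 2 * nvars n" by simp
  then show ?thesis using \<open>0 < levels n\<close> by (simp flip: power_Suc)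
qed

lemma poly_bounded_base: "poly_bounded base"
proof (rule poly_bounded_mono)
  show "poly_bounded (\<lambda>n. 2 * nvars n + k)"
    by (intro poly_bounded_intros poly_bounded_nvars)
qed (use power_levels_le in \<open>simp add: base_def\<close>)

lemma poly_bounded_layer_cost: "poly_bounded (layer_cost E)"
  unfolding layer_cost_def gate_cost_def horner_cost_def
  by (intro poly_bounded_intros poly_bounded_base)

lemma poly_bounded_generator_cost: "poly_bounded generator_cost"
  unfolding generator_cost_def setup_cost_def phase_cost_def refines_cost_def refine_cost_def
    leaves_cost_def horner_cost_def
  by (intro poly_bounded_intros poly_bounded_base poly_bounded_levels poly_bounded_nvars
      poly_bounded_layer_cost)

lemma generator_poly_time: "outputs_in_poly_time generator (\<lambda>n. encode_circuit (circ n))"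
proof -
  obtain p :: "nat poly" where p: "\<And>n. generator_cost n \<le> poly p n"
    using poly_bounded_generator_cost by (auto simp: poly_bounded_def)
  have "\<exists>t s. exec generator (initial n) t s \<and> emitted s = encode_circuit (circ n) \<and> t \<le> poly p n" for n
  proof -
    obtain g where g: "tr 1 (reg (initial n)) generator 6 g (encode_circuit (circ n)) (generator_cost n)"
      using tr_generator[of "reg (initial n)" n] by (auto simp: initial_def)
    from trE[OF g, of "initial n"] obtain t s where "exec generator (initial n) t s"
      "t \<le> generator_cost n" "emitted s = emitted (initial n) @ encode_circuit (circ n)" by blast
    then show ?thesis using p[of n] by (auto simp: initial_def intro: order_trans)
  qed
  then show ?thesis unfolding outputs_in_poly_time_def by blast
qed

lemma circ_poly_size: "poly_bounded (\<lambda>n. circuit_size (circ n))"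
  unfolding circuit_size_def length_nodes length_layers width_def Suc_eq_plus1
  by (intro poly_bounded_intros poly_bounded_base poly_bounded_levels)

lemma depth_circ_bigo: "(\<lambda>n. real (depth (circ n))) \<in> O(\<lambda>n. (log 2 (real n))\<^sup>2)"
proof (rule bigoI)
  \<comment> \<open>\<open>levels n\<close> is at most \<open>log 2 (k + 1) + log 2 n + 1\<close>;
    for \<open>n \<ge> 2\<close> the logarithm of \<open>n\<close> is at least 1 and absorbs the
    constant terms, which gives \<open>?c\<close>. In \<open>?K\<close>, the summand 1 accounts for
    the \<open>Commit\<close> layers.\<close>
  let ?c = "log 2 (real (k + 1)) + 2" and ?K = "k ^ k * k + 1"
  show "\<forall>\<^sub>F n in sequentially. norm (real (depth (circ n)))
      \<le> real ?K * ?c\<^sup>2 * norm ((log 2 (real n))\<^sup>2)"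
  proof (rule eventually_sequentiallyI[of 2])
    fix n :: nat assume n: "2 \<le> n"
    have H: "0 < levels n" unfolding less_levels_iff by (simp add: nvars_def)
    then have "2 ^ (levels n - 1) \<le> nvars n" unfolding less_levels_iff[symmetric] by simp
    then have "real (levels n - 1) \<le> log 2 (nvars n)" by (rule le_log2_of_power)
    also have "\<dots> \<le> log 2 (real ((k + 1) * n))"
      using n by (intro log_mono) (simp_all add: nvars_def add_pos_nonneg)
    also have "\<dots> = log 2 (real (k + 1)) + log 2 n"
      unfolding of_nat_mult by (subst log_mult) (use n in auto)
    finally have "real (levels n) \<le> log 2 (real (k + 1)) + log 2 n + 1" using H by simp
    moreover have l: "1 \<le> log 2 (real n)" using n by simp
    moreover have "0 \<le> log 2 (real (k + 1))" by simp
    then have "log 2 (real (k + 1)) * 1 \<le> log 2 (real (k + 1)) * log 2 n" using l by (intro mult_left_mono) auto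
    ultimately have le: "real (levels n) \<le> ?c * log 2 n" by (simp add: algebra_simps)
    have "depth (circ n) \<le> levels n * (levels n * (k ^ k * k) + 1)"
      using depth_circ[of n] by (simp add: length_layers)
    also have "\<dots> \<le> levels n * (levels n * (k ^ k * k) + levels n)"
      using H by (intro mult_le_mono2 add_left_mono) simp
    also have "\<dots> = ?K * (levels n)\<^sup>2" by (simp add: power2_eq_square algebra_simps)
    finally have "real (depth (circ n)) \<le> real ?K * (real (levels n))\<^sup>2"
      by (metis of_nat_le_iff of_nat_mult of_nat_power)
    also have "\<dots> \<le> real ?K * (?c * log 2 n)\<^sup>2"
      using le by (intro mult_left_mono power_mono) auto
    finally show "norm (real (depth (circ n))) \<le> real ?K * ?c\<^sup>2 * norm ((log 2 (real n))\<^sup>2)"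
      by (simp add: power_mult_distrib mult.assoc)
  qed
qed

end

theorem theorem3:
  fixes k :: nat
  assumes "k \<ge> 3"
  shows "\<exists>(P :: com) (C :: nat \<Rightarrow> circuit).
    outputs_in_poly_time P (\<lambda>n. encode_circuit (C n)) \<and>
    (\<forall>n. thr2_circuit (k + 1) (k * n + 1) (C n) \<and>
         computes (C n) (k * n + 1) (thr (n + 1))) \<and>
    (\<lambda>n. real (depth (C n))) \<in> O(\<lambda>n. (log 2 (real n))\<^sup>2) \<and>
    (\<exists>q :: nat poly. \<forall>n. circuit_size (C n) \<le> poly q n)"
proof -
  interpret arity k by unfold_locales (use assms in simp)
  show ?thesis
    using generator_poly_time thr2_circuit_circ computes_circ depth_circ_bigo circ_poly_size
    unfolding nvars_def poly_bounded_def by blast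
qed

end
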